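(* Let $\Phi$ be a TD system on $V$ of $q$-Racah type with diameter $d\ge1$ and associated nonzero scalars $q,a,b\in\mathbb{K}$, and let $K,R,\psi\in\mathrm{End}(V)$ be the associated linear transformations. Then there exists a $U_q(\mathfrak{sl}_2)$-module structure on $V$ for which the Chevalley generators $e,f,k,k^{-1}$ act on $V$ as $$e\mapsto (q-q^{-1})^{-1}\psi,\qquad f\mapsto (q-q^{-1})^{-1}R,\qquad k\mapsto K,\qquad k^{-1}\mapsto K^{-1}.$$
   Context: Let $\mathbb{K}$ be an algebraically closed field, $V$ a nonzero finite-dimensional $\mathbb{K}$-vector space, $\mathrm{End}(V)$ the algebra of linear maps $V\to V$, and $I$ the identity. TD pairs and systems. A tridiagonal (TD) pair on $V$ is an ordered pair $A,A^*\in\mathrm{End}(V)$ such that: (i) each of $A,A^*$ is diagonalizable; (ii) there is an ordering $\{V_i\}_{i=0}^d$ of the eigenspaces of $A$ with $A^*V_i\subseteq V_{i-1}+V_i+V_{i+1}$ for $0\le i\le d$ ($V_{-1}=V_{d+1}=0$); (iii) there is an ordering $\{V_i^*\}_{i=0}^\delta$ of the eigenspaces of $A^*$ with $AV_i^*\subseteq V_{i-1}^*+V_i^*+V_{i+1}^*$ for $0\le i\le \delta$ ($V^*_{-1}=V^*_{\delta+1}=0$); (iv) there is no subspace $W$ with $AW\subseteq W$, $A^*W\subseteq W$, $W\ne0$, $W\neq V$. It is known that $d=\delta$ (the diameter); assume $d\ge1$. Orderings as in (ii), (iii) are called standard. The primitive idempotent for an eigenspace of a diagonalizable map is the projection onto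 it along the sum of the other eigenspaces; an ordering of the primitive idempotents is standard if the corresponding ordering of eigenspaces is. A TD system on $V$ is a sequence $\Phi=(A;\{E_i\}_{i=0}^d;A^*;\{E_i^*\}_{i=0}^d)$ where $A,A^*$ is a TD pair on $V$ and $\{E_i\}$ (resp. $\{E_i^*\}$) is a standard ordering of the primitive idempotents of $A$ (resp. $A^*$). Let $\theta_i$ (resp. $\theta_i^*$) be the eigenvalue of $A$ (resp. $A^*$) for $E_i$ (resp. $E_i^*$). $\Phi$ has $q$-Racah type, with scalars $q,a,b$, if $q,a,b\in\mathbb{K}$ are nonzero, $q^4\ne1$, and $\theta_i=aq^{d-2i}+a^{-1}q^{2i-d}$, $\theta_i^*=bq^{d-2i}+b^{-1}q^{2i-d}$ for $0\le i\le d$. Split decomposition. For $0\le i\le d$ let $U_i=(E_0^*V+\cdots+E_i^*V)\cap(E_iV+\cdots+E_dV)$. It is known that $V=\bigoplus_{i=0}^dU_i$, with all summands nonzero. For $0\le i\le d/2$ let $K_i=(E_0^*V+\cdots+E_i^*V)\cap(E_iV+\cdots+E_{d-i}V)$. The maps. $K\in\mathrm{End}(V)$ acts on $U_i$ as $q^{d-2i}I$ for $0\le i\le d$; it is invertible. Put $R=A-aK-a^{-1}K^{-1}$. The map $\psi$ is the element of $\mathrm{End}(V)$, known to exist and be unique, such that $\psi R-R\psi=(q-q^{-1})(K-K^{-1})$ and $\psi K_i=0$ for $0\le i\le d/2$. $U_q(\mathfrak{sl}_2)$ is the unital associative $\mathbb{K}$-algebra with generators $e,f,k,k^{-1}$ (Chevalley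 generators) and relations $kk^{-1}=k^{-1}k=1$, $kek^{-1}=q^2e$, $kfk^{-1}=q^{-2}f$, $ef-fe=\frac{k-k^{-1}}{q-q^{-1}}$. *)

theory Defs
  imports
    "HOL-Computational_Algebra.Polynomial"
    "HOL-Library.Poly_Mapping"
    "HOL-Algebra.QuotRing"
begin

section \<open>Tridiagonal systems\<close>

text \<open>
  The vector space $V$ is the whole type \<open>'v\<close>, with scalar multiplication \<open>scale\<close>.
  An element of $\mathrm{End}(V)$ is a function \<open>X\<close> with \<open>Vector_Spaces.linear scale scale X\<close>,
  and a sum of subspaces is the span of their union.
\<close>

definition eigenspace :: "('k::field \<Rightarrow> 'v::ab_group_add \<Rightarrow> 'v) \<Rightarrow> ('v \<Rightarrow> 'v) \<Rightarrow> 'k \<Rightarrow> 'v set" where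
  "eigenspace scale A \<theta> = {v. A v = scale \<theta> v}"

definition eigenspaces :: "('k::field \<Rightarrow> 'v::ab_group_add \<Rightarrow> 'v) \<Rightarrow> ('v \<Rightarrow> 'v) \<Rightarrow> 'v set set" where
  "eigenspaces scale A = {eigenspace scale A \<theta> | \<theta>. eigenspace scale A \<theta> \<noteq> {0}}"

definition diagonalizable :: "('k::field \<Rightarrow> 'v::ab_group_add \<Rightarrow> 'v) \<Rightarrow> ('v \<Rightarrow> 'v) \<Rightarrow> bool" where
  "diagonalizable scale A \<longleftrightarrow> module.span scale (\<Union>(eigenspaces scale A)) = UNIV"

text \<open>
  \<open>W 0, \<dots>, W d\<close> lists each eigenspace of \<open>A\<close> exactly once, and \<open>B\<close> acts on the list in a
  tridiagonal fashion. The index set below is $\{i-1, i, i+1\} \cap \{0, \dots, d\}$.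
\<close>

definition standard_ordering ::
  "('k::field \<Rightarrow> 'v::ab_group_add \<Rightarrow> 'v) \<Rightarrow> ('v \<Rightarrow> 'v) \<Rightarrow> ('v \<Rightarrow> 'v) \<Rightarrow> nat \<Rightarrow> (nat \<Rightarrow> 'v set) \<Rightarrow> bool" where
  "standard_ordering scale A B d W \<longleftrightarrow>
     bij_betw W {..d} (eigenspaces scale A) \<and>
     (\<forall>i\<le>d. B ` W i \<subseteq> module.span scale (\<Union>j\<in>{j. j \<le> d \<and> i \<le> j + 1 \<and> j \<le> i + 1}. W j))"

definition TD_pair :: "('k::field \<Rightarrow> 'v::ab_group_add \<Rightarrow> 'v) \<Rightarrow> ('v \<Rightarrow> 'v) \<Rightarrow> ('v \<Rightarrow> 'v) \<Rightarrow> bool" where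
  "TD_pair scale A As \<longleftrightarrow>
     Vector_Spaces.linear scale scale A \<and> Vector_Spaces.linear scale scale As \<and>
     diagonalizable scale A \<and> diagonalizable scale As \<and>
     (\<exists>d W. standard_ordering scale A As d W) \<and>
     (\<exists>\<delta> Ws. standard_ordering scale As A \<delta> Ws) \<and>
     \<not> (\<exists>W. module.subspace scale W \<and> A ` W \<subseteq> W \<and> As ` W \<subseteq> W \<and> W \<noteq> {0} \<and> W \<noteq> UNIV)"

text \<open>\<open>P\<close> is the projection onto the eigenspace \<open>W\<close> of \<open>A\<close> along the sum of the other eigenspaces.\<close>

definition primitive_idempotent ::
  "('k::field \<Rightarrow> 'v::ab_group_add \<Rightarrow> 'v) \<Rightarrow> ('v \<Rightarrow> 'v) \<Rightarrow> 'v set \<Rightarrow> ('v \<Rightarrow> 'v) \<Rightarrow> bool" where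
  "primitive_idempotent scale A W P \<longleftrightarrow>
     W \<in> eigenspaces scale A \<and> Vector_Spaces.linear scale scale P \<and>
     (\<forall>w\<in>W. P w = w) \<and>
     (\<forall>w\<in>module.span scale (\<Union>(eigenspaces scale A - {W})). P w = 0)"

text \<open>Only the values \<open>E i\<close> and \<open>Es i\<close> with \<open>i \<le> d\<close> are relevant.\<close>

definition TD_system ::
  "('k::field \<Rightarrow> 'v::ab_group_add \<Rightarrow> 'v) \<Rightarrow> nat \<Rightarrow>
   ('v \<Rightarrow> 'v) \<Rightarrow> (nat \<Rightarrow> 'v \<Rightarrow> 'v) \<Rightarrow> ('v \<Rightarrow> 'v) \<Rightarrow> (nat \<Rightarrow> 'v \<Rightarrow> 'v) \<Rightarrow> bool" where
  "TD_system scale d A E As Es \<longleftrightarrow>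
     TD_pair scale A As \<and>
     (\<exists>W. standard_ordering scale A As d W \<and>
          (\<forall>i\<le>d. primitive_idempotent scale A (W i) (E i))) \<and>
     (\<exists>Ws. standard_ordering scale As A d Ws \<and>
          (\<forall>i\<le>d. primitive_idempotent scale As (Ws i) (Es i)))"

text \<open>For a primitive idempotent \<open>P\<close> of \<open>A\<close>, the \<open>\<theta>\<close> such that \<open>P V\<close> is the \<open>\<theta>\<close>-eigenspace.\<close>

definition eigenvalue_for ::
  "('k::field \<Rightarrow> 'v::ab_group_add \<Rightarrow> 'v) \<Rightarrow> ('v \<Rightarrow> 'v) \<Rightarrow> ('v \<Rightarrow> 'v) \<Rightarrow> 'k \<Rightarrow> bool" where
  "eigenvalue_for scale A P \<theta> \<longleftrightarrow> range P = eigenspace scale A \<theta>"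

definition q_Racah_type ::
  "('k::field \<Rightarrow> 'v::ab_group_add \<Rightarrow> 'v) \<Rightarrow> nat \<Rightarrow>
   ('v \<Rightarrow> 'v) \<Rightarrow> (nat \<Rightarrow> 'v \<Rightarrow> 'v) \<Rightarrow> ('v \<Rightarrow> 'v) \<Rightarrow> (nat \<Rightarrow> 'v \<Rightarrow> 'v) \<Rightarrow> 'k \<Rightarrow> 'k \<Rightarrow> 'k \<Rightarrow> bool" where
  "q_Racah_type scale d A E As Es q a b \<longleftrightarrow>
     q \<noteq> 0 \<and> a \<noteq> 0 \<and> b \<noteq> 0 \<and> q ^ 4 \<noteq> 1 \<and>
     (\<forall>i\<le>d. eigenvalue_for scale A (E i)
              (a * q powi (int d - 2 * int i) + inverse a * q powi (2 * int i - int d)) \<and>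
            eigenvalue_for scale As (Es i)
              (b * q powi (int d - 2 * int i) + inverse b * q powi (2 * int i - int d)))"

section \<open>The split decomposition and the maps $K$, $R$, $\psi$\<close>

definition split_U ::
  "('k::field \<Rightarrow> 'v::ab_group_add \<Rightarrow> 'v) \<Rightarrow> nat \<Rightarrow> (nat \<Rightarrow> 'v \<Rightarrow> 'v) \<Rightarrow> (nat \<Rightarrow> 'v \<Rightarrow> 'v) \<Rightarrow> nat \<Rightarrow> 'v set" where
  "split_U scale d E Es i =
     module.span scale (\<Union>j\<in>{0..i}. range (Es j)) \<inter> module.span scale (\<Union>j\<in>{i..d}. range (E j))"

definition split_K_space ::
  "('k::field \<Rightarrow> 'v::ab_group_add \<Rightarrow> 'v) \<Rightarrow> nat \<Rightarrow> (nat \<Rightarrow> 'v \<Rightarrow> 'v) \<Rightarrow> (nat \<Rightarrow> 'v \<Rightarrow> 'v) \<Rightarrow> nat \<Rightarrow> 'v set" where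
  "split_K_space scale d E Es i =
     module.span scale (\<Union>j\<in>{0..i}. range (Es j)) \<inter> module.span scale (\<Union>j\<in>{i..d - i}. range (E j))"

text \<open>Since $V$ is the direct sum of the $U_i$, there is exactly one such \<open>K\<close>, and it is bijective.\<close>

definition is_K_map ::
  "('k::field \<Rightarrow> 'v::ab_group_add \<Rightarrow> 'v) \<Rightarrow> nat \<Rightarrow> (nat \<Rightarrow> 'v \<Rightarrow> 'v) \<Rightarrow> (nat \<Rightarrow> 'v \<Rightarrow> 'v) \<Rightarrow> 'k \<Rightarrow> ('v \<Rightarrow> 'v) \<Rightarrow> bool" where
  "is_K_map scale d E Es q K \<longleftrightarrow>
     Vector_Spaces.linear scale scale K \<and>
     (\<forall>i\<le>d. \<forall>u\<in>split_U scale d E Es i. K u = scale (q powi (int d - 2 * int i)) u)"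

text \<open>
  The inverse of a bijection \<open>K\<close> is written \<open>inv_into UNIV K\<close>,
  because HOL-Algebra uses the notation \<open>inv\<close> for the inverse in a monoid.
\<close>

definition R_map ::
  "('k::field \<Rightarrow> 'v::ab_group_add \<Rightarrow> 'v) \<Rightarrow> 'k \<Rightarrow> ('v \<Rightarrow> 'v) \<Rightarrow> ('v \<Rightarrow> 'v) \<Rightarrow> 'v \<Rightarrow> 'v" where
  "R_map scale a A K = (\<lambda>v. A v - scale a (K v) - scale (inverse a) (inv_into UNIV K v))"

definition is_psi_map ::
  "('k::field \<Rightarrow> 'v::ab_group_add \<Rightarrow> 'v) \<Rightarrow> nat \<Rightarrow> (nat \<Rightarrow> 'v \<Rightarrow> 'v) \<Rightarrow> (nat \<Rightarrow> 'v \<Rightarrow> 'v) \<Rightarrow> 'k \<Rightarrow>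
   ('v \<Rightarrow> 'v) \<Rightarrow> ('v \<Rightarrow> 'v) \<Rightarrow> ('v \<Rightarrow> 'v) \<Rightarrow> bool" where
  "is_psi_map scale d E Es q K R \<psi> \<longleftrightarrow>
     Vector_Spaces.linear scale scale \<psi> \<and>
     (\<forall>v. \<psi> (R v) - R (\<psi> v) = scale (q - inverse q) (K v - inv_into UNIV K v)) \<and>
     (\<forall>i. 2 * i \<le> d \<longrightarrow> (\<forall>u\<in>split_K_space scale d E Es i. \<psi> u = 0))"

section \<open>The algebra $U_q(\mathfrak{sl}_2)$ and its modules\<close>

text \<open>
  Words in the generators form the free monoid, written additively so that the convolution
  product of the library makes \<open>chev free_word \<Rightarrow>\<^sub>0 'k\<close> the free unital associative algebra on \<open>chev\<close>.
\<close>

datatype chev = Gen_e | Gen_f | Gen_k | Gen_ki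

datatype 'a free_word = Word (letters: "'a list")

instantiation free_word :: (type) monoid_add
begin

definition zero_free_word :: "'a free_word" where
  "0 = Word []"

definition plus_free_word :: "'a free_word \<Rightarrow> 'a free_word \<Rightarrow> 'a free_word" where
  "u + w = Word (letters u @ letters w)"

instance
  by intro_classes (auto simp: zero_free_word_def plus_free_word_def)

end

definition free_gen :: "chev \<Rightarrow> (chev free_word \<Rightarrow>\<^sub>0 'k::field)" where
  "free_gen x = Poly_Mapping.single (Word [x]) 1"

definition free_const :: "'k::field \<Rightarrow> (chev free_word \<Rightarrow>\<^sub>0 'k)" where
  "free_const c = Poly_Mapping.single 0 c"

definition free_alg :: "(chev free_word \<Rightarrow>\<^sub>0 'k::field) ring" where
  "free_alg = \<lparr>carrier = UNIV, mult = (*), one = 1, zero = 0, add = (+)\<rparr>"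

definition Uq_relators :: "'k::field \<Rightarrow> (chev free_word \<Rightarrow>\<^sub>0 'k) set" where
  "Uq_relators q =
     (let e = free_gen Gen_e; f = free_gen Gen_f; k = free_gen Gen_k; ki = free_gen Gen_ki in
       {k * ki - 1,
        ki * k - 1,
        k * e * ki - free_const (q ^ 2) * e,
        k * f * ki - free_const (inverse q ^ 2) * f,
        e * f - f * e - free_const (inverse (q - inverse q)) * (k - ki)})"

text \<open>Ideals in HOL-Algebra are two-sided, so this is the algebra presented by the relations.\<close>

definition Uq_ideal :: "'k::field \<Rightarrow> (chev free_word \<Rightarrow>\<^sub>0 'k) set" where
  "Uq_ideal q = Idl\<^bsub>free_alg\<^esub> (Uq_relators q)"

definition Uq :: "'k::field \<Rightarrow> (chev free_word \<Rightarrow>\<^sub>0 'k) set ring" where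
  "Uq q = free_alg Quot (Uq_ideal q)"

definition Uq_class :: "'k::field \<Rightarrow> (chev free_word \<Rightarrow>\<^sub>0 'k) \<Rightarrow> (chev free_word \<Rightarrow>\<^sub>0 'k) set" where
  "Uq_class q x = Uq_ideal q +>\<^bsub>free_alg\<^esub> x"

definition Uq_gen :: "'k::field \<Rightarrow> chev \<Rightarrow> (chev free_word \<Rightarrow>\<^sub>0 'k) set" where
  "Uq_gen q x = Uq_class q (free_gen x)"

text \<open>
  A left module over the \<open>'k\<close>-algebra \<open>Uq q\<close> on the vector space \<open>'v\<close>: the last clause says that
  the scalars of the algebra act by the given scalar multiplication, so that the action is
  \<open>'k\<close>-bilinear. The values of \<open>act\<close> outside the carrier are irrelevant.
\<close>

definition Uq_module ::
  "'k::field \<Rightarrow> ('k \<Rightarrow> 'v::ab_group_add \<Rightarrow> 'v) \<Rightarrow> ((chev free_word \<Rightarrow>\<^sub>0 'k) set \<Rightarrow> 'v \<Rightarrow> 'v) \<Rightarrow> bool" where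
  "Uq_module q scale act \<longleftrightarrow>
     (\<forall>x\<in>carrier (Uq q). \<forall>v w. act x (v + w) = act x v + act x w) \<and>
     (\<forall>x\<in>carrier (Uq q). \<forall>y\<in>carrier (Uq q). \<forall>v. act (x \<oplus>\<^bsub>Uq q\<^esub> y) v = act x v + act y v) \<and>
     (\<forall>x\<in>carrier (Uq q). \<forall>y\<in>carrier (Uq q). \<forall>v. act (x \<otimes>\<^bsub>Uq q\<^esub> y) v = act x (act y v)) \<and>
     (\<forall>v. act \<one>\<^bsub>Uq q\<^esub> v = v) \<and>
     (\<forall>c v. act (Uq_class q (free_const c)) v = scale c v)"

lemma ring_free_alg: "ring (free_alg :: (chev free_word \<Rightarrow>\<^sub>0 'k::field) ring)"
proof (rule ringI)
  show "abelian_group (free_alg :: (chev free_word \<Rightarrow>\<^sub>0 'k) ring)"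
  proof (rule abelian_groupI)
    fix x :: "chev free_word \<Rightarrow>\<^sub>0 'k"
    show "\<exists>y\<in>carrier free_alg. y \<oplus>\<^bsub>free_alg\<^esub> x = \<zero>\<^bsub>free_alg\<^esub>"
      by (rule bexI[of _ "- x"]) (simp_all add: free_alg_def)
  qed (simp_all add: free_alg_def ac_simps)
  show "Group.monoid (free_alg :: (chev free_word \<Rightarrow>\<^sub>0 'k) ring)"
    by (rule monoidI) (simp_all add: free_alg_def mult.assoc)
qed (simp_all add: free_alg_def distrib_left distrib_right)

lemma ideal_Uq_ideal: "ideal (Uq_ideal q) free_alg"
  unfolding Uq_ideal_def
  by (rule ring.genideal_ideal[OF ring_free_alg]) (simp add: free_alg_def)

lemma ring_Uq: "ring (Uq q)"
  unfolding Uq_def by (rule ideal.quotient_is_ring[OF ideal_Uq_ideal])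

end

theory Submission
  imports Defs
begin

text \<open>
  Most of the defining relations hold for formal reasons. On $U_i$ the map $R$ acts as $A - \theta_i$,
  because $aK + a^{-1}K^{-1}$ has the eigenvalue $\theta_i$ there; so $R U_i \subseteq U_{i+1}$, which is
  the relation between $k$ and $f$. The relation between $e$ and $f$ is the defining property of $\psi$.
  What remains is $K\psi = q^2\psi K$, that is, $\psi U_i \subseteq U_{i-1}$.

  It suffices to know that $V$ is spanned by the strings $R^m h$ with $h \in K_i$ and $i \le d/2$: since
  $\psi h = 0$, the commutation relation gives $\psi R^m h$ as a multiple of $R^{m-1}h$
  (\<open>q_commutator_string\<close>), which has the right weight. The spanning property is extracted from $\psi$
  itself. Let $L$ be the component of $\psi$ that maps each $U_i$ to $U_{i-1}$. It satisfies the same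
  commutation relation (\<open>homogeneous_q_commutator\<close>), so $L$, $R$, $K$ form an $\mathfrak{sl}_2$-type
  triple with weights $q^{d-2i}$, $0 \le i \le d$. As the $\theta_i$ are distinct, $q^{2m} \ne 1$ for
  $1 \le m \le d$, and the theory of strings shows that $V$ is spanned by strings $R^m h$ with
  $h \in U_i$, $i \le d/2$ and $R^{d-2i+1}h = 0$ (\<open>strings_span\<close>). The last condition reads
  $(A - \theta_i) \cdots (A - \theta_{d-i})h = 0$, which places $h$ in $E_iV + \cdots + E_{d-i}V$ and
  therefore in $K_i$ (\<open>killed_by_factors\<close>).

  All of this rests on $V = U_0 + \cdots + U_d$ (\<open>split_span\<close>): the sum is invariant under $A$ and $A^*$,
  hence equal to $V$ by irreducibility. Directness of the sum is then a consequence of the existence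
  of $K$, which has the distinct eigenvalues $q^{d-2i}$ on the summands.
\<close>

section \<open>Endomorphisms and their eigenprojections\<close>

locale linear_endos = vector_space scale
  for scale :: "'k::field \<Rightarrow> 'v::ab_group_add \<Rightarrow> 'v"
begin

abbreviation endo :: "('v \<Rightarrow> 'v) \<Rightarrow> bool" where
  "endo X \<equiv> Vector_Spaces.linear scale scale X"

lemma endoI:
  assumes "\<And>u v. X (u + v) = X u + X v" and "\<And>c v. X (scale c v) = scale c (X v)"
  shows "endo X"
  unfolding Vector_Spaces.linear_iff using assms vector_space_axioms by blast

lemma endo_simps:
  assumes "endo X"
  shows "X (u + v) = X u + X v" and "X (u - v) = X u - X v" and "X (scale c v) = scale c (X v)"
    and "X 0 = 0" and "X (sum f I) = (\<Sum>i\<in>I. X (f i))"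
proof -
  interpret X: Vector_Spaces.linear scale scale X by fact
  show "X (u + v) = X u + X v" "X (u - v) = X u - X v" "X (scale c v) = scale c (X v)"
    "X 0 = 0" "X (sum f I) = (\<Sum>i\<in>I. X (f i))"
    by (rule X.add X.diff X.scale X.zero X.sum)+
qed

lemma endo_shift: "endo X \<Longrightarrow> endo (\<lambda>v. X v - scale t v)"
  by (rule endoI) (simp_all add: endo_simps algebra_simps)

lemma endo_funpow: "endo X \<Longrightarrow> endo (X ^^ n)"
  by (induction n) (auto intro!: endoI simp: endo_simps)

lemma endo_span_into:
  assumes "endo X" and "v \<in> span S" and "\<And>s. s \<in> S \<Longrightarrow> X s \<in> T" and "subspace T"
  shows "X v \<in> T"
proof -
  have "subspace {v. X v \<in> T}"
    using assms(1,4) by (auto simp: subspace_def endo_simps)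
  then have "span S \<subseteq> {v. X v \<in> T}"
    using assms(3) by (intro span_minimal) auto
  then show ?thesis
    using assms(2) by blast
qed

lemma endo_eq_on_span:
  assumes "endo X" and "endo Y" and "span S = UNIV" and "\<And>s. s \<in> S \<Longrightarrow> X s = Y s"
  shows "X v = Y v"
proof -
  have "endo (\<lambda>v. X v - Y v)"
    using assms(1,2) by (intro endoI) (simp_all add: endo_simps algebra_simps)
  then have "X v - Y v \<in> {0}"
    by (rule endo_span_into[where S = S]) (use assms(3,4) in \<open>auto simp: subspace_def\<close>)
  then show ?thesis by simp
qed

lemma eigenspace_iff: "v \<in> eigenspace scale X t \<longleftrightarrow> X v = scale t v"
  by (simp add: eigenspace_def)

lemma subspace_eigenspace: "endo X \<Longrightarrow> subspace (eigenspace scale X t)"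
  by (auto simp: subspace_def eigenspace_def endo_simps algebra_simps)

text \<open>
  This is Lagrange interpolation: the map is a scalar multiple of the product of the \<open>X - s\<close>
  over \<open>s \<in> S\<close>. Building the product one factor at a time avoids polynomials in \<open>X\<close>.
\<close>

lemma separate_eigenspaces:
  assumes "endo X" and "finite S" and "t \<notin> S"
  shows "\<exists>P. endo P \<and> (\<forall>v. X v = scale t v \<longrightarrow> P v = v) \<and> (\<forall>s\<in>S. \<forall>v. X v = scale s v \<longrightarrow> P v = 0)"
  using assms(2,3)
proof (induction S)
  case empty
  show ?case
    by (rule exI[of _ "\<lambda>v. v"]) (auto intro: endoI)
next
  case (insert s S)
  then obtain P where P: "endo P" "\<And>v. X v = scale t v \<Longrightarrow> P v = v"
      "\<And>r v. r \<in> S \<Longrightarrow> X v = scale r v \<Longrightarrow> P v = 0"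
    by auto
  have ts: "t - s \<noteq> 0" using insert.prems by auto
  let ?Q = "\<lambda>v. scale (inverse (t - s)) (P (X v) - scale s (P v))"
  have "endo ?Q"
    using P(1) assms(1) by (intro endoI) (simp_all add: endo_simps algebra_simps)
  moreover have "?Q v = v" if "X v = scale t v" for v
    using P(1) P(2)[OF that] ts that
    by (simp add: endo_simps flip: scale_left_diff_distrib)
  moreover have "?Q v = 0" if "r \<in> insert s S" "X v = scale r v" for r v
    using P(1) P(3)[of r v] that by (auto simp: endo_simps)
  ultimately show ?case by blast
qed

text \<open>
  The working form of ``$V$ is the direct sum of the eigenspaces'': the eigenspaces span by
  assumption, and distinctness of the eigenvalues supplies directness through interpolation.
\<close>

lemma eigenprojections_exist:
  fixes \<theta> :: "nat \<Rightarrow> 'k"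
  assumes "endo X" and "inj_on \<theta> {..d}" and "span (\<Union>i\<le>d. eigenspace scale X (\<theta> i)) = UNIV"
  obtains P where "\<And>i. i \<le> d \<Longrightarrow> endo (P i)"
    and "\<And>i v. i \<le> d \<Longrightarrow> P i v \<in> eigenspace scale X (\<theta> i)"
    and "\<And>i j v. i \<le> d \<Longrightarrow> j \<le> d \<Longrightarrow> v \<in> eigenspace scale X (\<theta> j) \<Longrightarrow> P i v = (if i = j then v else 0)"
    and "\<And>v. (\<Sum>i\<le>d. P i v) = v"
proof -
  have "\<exists>P. endo P \<and> (\<forall>v. X v = scale (\<theta> i) v \<longrightarrow> P v = v) \<and>
      (\<forall>s\<in>\<theta> ` ({..d} - {i}). \<forall>v. X v = scale s v \<longrightarrow> P v = 0)" if "i \<le> d" for i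
    using that assms(1,2) by (intro separate_eigenspaces) (auto simp: inj_on_def)
  then have "\<exists>P. \<forall>i. i \<le> d \<longrightarrow> endo (P i) \<and> (\<forall>v. X v = scale (\<theta> i) v \<longrightarrow> P i v = v) \<and>
      (\<forall>s\<in>\<theta> ` ({..d} - {i}). \<forall>v. X v = scale s v \<longrightarrow> P i v = 0)"
    by (intro choice) blast
  then obtain P where lin: "\<And>i. i \<le> d \<Longrightarrow> endo (P i)"
    and same: "\<And>i v. i \<le> d \<Longrightarrow> X v = scale (\<theta> i) v \<Longrightarrow> P i v = v"
    and other: "\<And>i s v. i \<le> d \<Longrightarrow> s \<in> \<theta> ` ({..d} - {i}) \<Longrightarrow> X v = scale s v \<Longrightarrow> P i v = 0"
    by blast
  have delta: "P i v = (if i = j then v else 0)"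
    if "i \<le> d" "j \<le> d" "v \<in> eigenspace scale X (\<theta> j)" for i j v
    using that same[of i v] other[of i "\<theta> j" v] by (auto simp: eigenspace_iff)
  have "P i v \<in> eigenspace scale X (\<theta> i)" if "i \<le> d" for i v
    by (rule endo_span_into[OF lin[OF that], where S = "\<Union>i\<le>d. eigenspace scale X (\<theta> i)"])
      (use assms that delta in \<open>auto simp: subspace_eigenspace subspace_0\<close>)
  moreover have "(\<Sum>i\<le>d. P i v) = v" for v
  proof (rule endo_eq_on_span[OF _ _ assms(3)])
    show "endo (\<lambda>v. \<Sum>i\<le>d. P i v)"
      by (rule endoI) (simp_all add: endo_simps[OF lin] sum.distrib scale_sum_right)
    show "endo (\<lambda>v. v)" by (rule endoI) auto
    fix v assume "v \<in> (\<Union>i\<le>d. eigenspace scale X (\<theta> i))"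
    then obtain j where j: "j \<le> d" "v \<in> eigenspace scale X (\<theta> j)" by auto
    have "(\<Sum>i\<le>d. P i v) = (\<Sum>i\<le>d. if i = j then v else 0)"
      using j by (intro sum.cong) (auto simp: delta)
    then show "(\<Sum>i\<le>d. P i v) = v" using j by simp
  qed
  ultimately show ?thesis using that lin delta by blast
qed

lemma invertible_if_nonzero_eigenvalues:
  fixes \<theta> :: "nat \<Rightarrow> 'k"
  assumes "endo X" and "inj_on \<theta> {..d}" and "span (\<Union>i\<le>d. eigenspace scale X (\<theta> i)) = UNIV"
    and nz: "\<And>i. i \<le> d \<Longrightarrow> \<theta> i \<noteq> 0"
  shows "bij X" and "endo (inv_into UNIV X)"
proof -
  obtain P where lin: "\<And>j. j \<le> d \<Longrightarrow> endo (P j)"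
    and P_in: "\<And>j v. j \<le> d \<Longrightarrow> P j v \<in> eigenspace scale X (\<theta> j)"
    and P_delta: "\<And>j l v. j \<le> d \<Longrightarrow> l \<le> d \<Longrightarrow> v \<in> eigenspace scale X (\<theta> l) \<Longrightarrow> P j v = (if j = l then v else 0)"
    and P_sum: "\<And>v. (\<Sum>j\<le>d. P j v) = v"
    using eigenprojections_exist[OF assms(1-3)] by blast
  define Y where "Y = (\<lambda>v. \<Sum>i\<le>d. scale (inverse (\<theta> i)) (P i v))"
  have endo_Y: "endo Y"
    unfolding Y_def
    by (rule endoI) (simp_all add: endo_simps[OF lin] sum.distrib scale_sum_right scale_right_distrib mult.commute)
  have XY: "X (Y v) = v" for v
  proof -
    have "X (Y v) = (\<Sum>i\<le>d. P i v)"
      unfolding Y_def endo_simps[OF assms(1)] using P_in nz by (intro sum.cong) (auto simp: eigenspace_iff)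
    then show ?thesis by (simp add: P_sum)
  qed
  have YX: "Y (X v) = v" for v
  proof (rule endo_eq_on_span[where X = "\<lambda>v. Y (X v)" and Y = "\<lambda>v. v", OF _ _ assms(3)])
    show "endo (\<lambda>v. Y (X v))" "endo (\<lambda>v. v)"
      using endo_Y assms(1) by (auto intro!: endoI simp: endo_simps)
    fix s assume "s \<in> (\<Union>j\<le>d. eigenspace scale X (\<theta> j))"
    then obtain l where l: "l \<le> d" "s \<in> eigenspace scale X (\<theta> l)" by auto
    have "Y s = (\<Sum>i\<le>d. if i = l then scale (inverse (\<theta> l)) s else 0)"
      unfolding Y_def using l by (intro sum.cong) (auto simp: P_delta)
    then have "Y s = scale (inverse (\<theta> l)) s" using l by simp
    then show "Y (X s) = s"
      using l endo_Y nz[OF l(1)] by (simp add: eigenspace_iff endo_simps)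
  qed
  show "bij X" by (rule o_bij[of Y]) (use XY YX in auto)
  have "inv_into UNIV X = Y"
    by (rule inv_unique_comp) (use XY YX in auto)
  then show "endo (inv_into UNIV X)" using endo_Y by simp
qed

end

section \<open>The split decomposition\<close>

text \<open>
  The part of a tridiagonal system that the split decomposition uses, with the primitive idempotents
  replaced by the eigenvalues of the eigenspaces that they project onto.
\<close>

locale tridiagonal_system = linear_endos scale
  for scale :: "'k::field \<Rightarrow> 'v::ab_group_add \<Rightarrow> 'v" +
  fixes A B :: "'v \<Rightarrow> 'v" and d :: nat and \<theta> \<phi> :: "nat \<Rightarrow> 'k"
  assumes endo_A: "endo A" and endo_B: "endo B"
    and inj_\<theta>: "inj_on \<theta> {..d}"
    and A_span: "span (\<Union>j\<le>d. eigenspace scale A (\<theta> j)) = UNIV"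
    and B_tridiagonal: "i \<le> d \<Longrightarrow> v \<in> eigenspace scale A (\<theta> i) \<Longrightarrow>
      B v \<in> span (\<Union>j\<in>{j. j \<le> d \<and> i \<le> j + 1 \<and> j \<le> i + 1}. eigenspace scale A (\<theta> j))"
    and A_tridiagonal: "i \<le> d \<Longrightarrow> v \<in> eigenspace scale B (\<phi> i) \<Longrightarrow>
      A v \<in> span (\<Union>j\<in>{j. j \<le> d \<and> i \<le> j + 1 \<and> j \<le> i + 1}. eigenspace scale B (\<phi> j))"
    and irreducible: "subspace W \<Longrightarrow> A ` W \<subseteq> W \<Longrightarrow> B ` W \<subseteq> W \<Longrightarrow> W = {0} \<or> W = UNIV"
    and B_eigenvector: "eigenspace scale B (\<phi> 0) \<noteq> {0}"
begin

definition flag :: "nat \<Rightarrow> 'v set" where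
  "flag i = span (\<Union>j\<in>{i..d}. eigenspace scale A (\<theta> j))"

definition dual_flag :: "nat \<Rightarrow> 'v set" where
  "dual_flag i = span (\<Union>j\<in>{0..i}. eigenspace scale B (\<phi> j))"

text \<open>
  The summand $U_i$ of the split decomposition. It is shown below that \<open>A\<close> raises and \<open>B\<close> lowers
  the index by one, up to the eigenvalues \<open>\<theta> i\<close> and \<open>\<phi> i\<close>.
\<close>

definition split_space :: "nat \<Rightarrow> 'v set" where
  "split_space i = dual_flag i \<inter> flag i"

lemma subspace_flags: "subspace (flag i)" "subspace (dual_flag i)" "subspace (split_space i)"
  by (simp_all add: flag_def dual_flag_def split_space_def subspace_inter)

lemma flag_0: "flag 0 = UNIV"
  using A_span by (simp add: flag_def atLeast0AtMost)

lemma dual_flag_0: "dual_flag 0 = eigenspace scale B (\<phi> 0)"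
  using subspace_eigenspace[OF endo_B] by (simp add: dual_flag_def span_eq_iff)

text \<open>
  \<open>A - \<theta> i\<close> deletes the lowest eigenspace from the flag. Tridiagonality is the other half of the
  mechanism: \<open>B\<close> enlarges a flag by at most one eigenspace. The dual flags behave in the same way
  with \<open>A\<close> and \<open>B\<close> exchanged.
\<close>

lemma A_shift_flag: "v \<in> flag i \<Longrightarrow> A v - scale (\<theta> i) v \<in> flag (Suc i)"
  unfolding flag_def[of i]
proof (rule endo_span_into[OF endo_shift[OF endo_A]])
  fix s assume "s \<in> (\<Union>j\<in>{i..d}. eigenspace scale A (\<theta> j))"
  then obtain j where j: "i \<le> j" "j \<le> d" "s \<in> eigenspace scale A (\<theta> j)" by auto
  have eq: "A s - scale (\<theta> i) s = scale (\<theta> j - \<theta> i) s"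
    using j(3) by (simp add: eigenspace_iff algebra_simps)
  show "A s - scale (\<theta> i) s \<in> flag (Suc i)"
  proof (cases "j = i")
    case True
    then show ?thesis using eq subspace_flags(1) by (simp add: subspace_0)
  next
    case False
    then have "s \<in> flag (Suc i)"
      unfolding flag_def using j by (intro span_base) auto
    then show ?thesis using eq subspace_flags(1) by (simp add: subspace_scale)
  qed
qed (simp_all add: subspace_flags)

lemma B_flag: "v \<in> flag (Suc i) \<Longrightarrow> B v \<in> flag i"
  unfolding flag_def[of "Suc i"]
proof (rule endo_span_into[OF endo_B])
  fix s assume "s \<in> (\<Union>j\<in>{Suc i..d}. eigenspace scale A (\<theta> j))"
  then obtain j where j: "Suc i \<le> j" "j \<le> d" "s \<in> eigenspace scale A (\<theta> j)" by auto
  have "span (\<Union>l\<in>{l. l \<le> d \<and> j \<le> l + 1 \<and> l \<le> j + 1}. eigenspace scale A (\<theta> l)) \<subseteq> flag i"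
    unfolding flag_def using j(1) by (intro span_mono UN_mono) auto
  then show "B s \<in> flag i"
    using B_tridiagonal[OF j(2,3)] by blast
qed (simp_all add: subspace_flags)

lemma dual_flag_mono: "i \<le> j \<Longrightarrow> dual_flag i \<subseteq> dual_flag j"
  unfolding dual_flag_def by (intro span_mono UN_mono) auto

lemma flag_mono: "i \<le> j \<Longrightarrow> flag j \<subseteq> flag i"
  unfolding flag_def by (intro span_mono UN_mono) auto

lemma B_shift_dual_flag: "v \<in> dual_flag (Suc i) \<Longrightarrow> B v - scale (\<phi> (Suc i)) v \<in> dual_flag i"
  unfolding dual_flag_def[of "Suc i"]
proof (rule endo_span_into[OF endo_shift[OF endo_B]])
  fix s assume "s \<in> (\<Union>j\<in>{0..Suc i}. eigenspace scale B (\<phi> j))"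
  then obtain j where j: "j \<le> Suc i" "s \<in> eigenspace scale B (\<phi> j)" by auto
  have eq: "B s - scale (\<phi> (Suc i)) s = scale (\<phi> j - \<phi> (Suc i)) s"
    using j(2) by (simp add: eigenspace_iff algebra_simps)
  show "B s - scale (\<phi> (Suc i)) s \<in> dual_flag i"
  proof (cases "j = Suc i")
    case True
    then show ?thesis using eq subspace_flags(2) by (simp add: subspace_0)
  next
    case False
    then have "s \<in> dual_flag i"
      unfolding dual_flag_def using j by (intro span_base) auto
    then show ?thesis using eq subspace_flags(2) by (simp add: subspace_scale)
  qed
qed (simp_all add: subspace_flags)

lemma A_dual_flag: "i < d \<Longrightarrow> v \<in> dual_flag i \<Longrightarrow> A v \<in> dual_flag (Suc i)"
  unfolding dual_flag_def[of i]
proof (rule endo_span_into[OF endo_A])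
  assume "i < d"
  fix s assume "s \<in> (\<Union>j\<in>{0..i}. eigenspace scale B (\<phi> j))"
  then obtain j where j: "j \<le> i" "s \<in> eigenspace scale B (\<phi> j)" by auto
  have "span (\<Union>l\<in>{l. l \<le> d \<and> j \<le> l + 1 \<and> l \<le> j + 1}. eigenspace scale B (\<phi> l)) \<subseteq> dual_flag (Suc i)"
    unfolding dual_flag_def using j(1) by (intro span_mono UN_mono) auto
  then show "A s \<in> dual_flag (Suc i)"
    using A_tridiagonal[OF _ j(2)] j(1) \<open>i < d\<close> by auto
qed (simp_all add: subspace_flags)

lemma A_split:
  assumes "i < d" and "v \<in> split_space i"
  shows "A v - scale (\<theta> i) v \<in> split_space (Suc i)"
proof -
  have "v \<in> dual_flag (Suc i)"
    using assms(2) dual_flag_mono[of i "Suc i"] by (auto simp: split_space_def)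
  then have "A v - scale (\<theta> i) v \<in> dual_flag (Suc i)"
    using assms A_dual_flag[of i v] subspace_flags(2)
    by (intro subspace_diff) (auto simp: split_space_def subspace_scale)
  then show ?thesis
    using assms(2) A_shift_flag by (simp add: split_space_def)
qed

lemma A_split_last: "v \<in> split_space d \<Longrightarrow> A v = scale (\<theta> d) v"
  using A_shift_flag[of v d] by (simp add: split_space_def flag_def)

lemma B_split:
  assumes "v \<in> split_space (Suc i)"
  shows "B v - scale (\<phi> (Suc i)) v \<in> split_space i"
proof -
  have "v \<in> flag i"
    using assms flag_mono[of i "Suc i"] by (auto simp: split_space_def)
  then have "B v - scale (\<phi> (Suc i)) v \<in> flag i"
    using assms B_flag[of v i] subspace_flags(1)
    by (intro subspace_diff) (auto simp: split_space_def subspace_scale)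
  then show ?thesis
    using assms B_shift_dual_flag by (simp add: split_space_def)
qed

text \<open>
  By the raising and lowering relations the sum of the $U_i$ is invariant under both \<open>A\<close> and \<open>B\<close>.
  It contains $U_0$, which is a whole eigenspace of \<open>B\<close> and so nonzero; irreducibility does the rest.
\<close>

lemma split_span: "span (\<Union>i\<le>d. split_space i) = UNIV"
proof -
  let ?W = "span (\<Union>i\<le>d. split_space i)"
  have in_W: "v \<in> ?W" if "i \<le> d" "v \<in> split_space i" for i v
    using that by (intro span_base) auto
  have shift: "X v \<in> ?W" if "X v - scale t v \<in> ?W" "v \<in> ?W" for X v t
    using span_add[OF that(1) span_scale[OF that(2), of t]] by simp
  have "A v \<in> ?W" if "v \<in> ?W" for v
  proof (rule endo_span_into[OF endo_A that])
    fix s assume "s \<in> (\<Union>i\<le>d. split_space i)"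
    then obtain i where i: "i \<le> d" "s \<in> split_space i" by auto
    then have "A s - scale (\<theta> i) s \<in> ?W"
      using A_split[of i s] A_split_last[of s] in_W[of "Suc i"]
      by (cases "i = d") (auto simp: span_zero)
    then show "A s \<in> ?W" using shift in_W i by blast
  qed simp
  moreover have "B v \<in> ?W" if "v \<in> ?W" for v
  proof (rule endo_span_into[OF endo_B that])
    fix s assume "s \<in> (\<Union>i\<le>d. split_space i)"
    then obtain i where i: "i \<le> d" "s \<in> split_space i" by auto
    have "B s - scale (\<phi> i) s \<in> ?W"
    proof (cases i)
      case 0
      then show ?thesis
        using i by (simp add: split_space_def dual_flag_0 eigenspace_iff span_zero)
    next
      case (Suc j)
      then show ?thesis
        using i B_split[of s j] in_W[of j] by simp
    qed
    then show "B s \<in> ?W" using shift in_W i by blast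
  qed simp
  ultimately have "?W = {0} \<or> ?W = UNIV"
    by (intro irreducible) auto
  moreover have "eigenspace scale B (\<phi> 0) \<subseteq> ?W"
    using in_W[of 0] by (auto simp: split_space_def dual_flag_0 flag_0)
  moreover have "0 \<in> eigenspace scale B (\<phi> 0)"
    using subspace_eigenspace[OF endo_B] by (rule subspace_0)
  ultimately show ?thesis using B_eigenvector by blast
qed

text \<open>
  Here \<open>w n\<close> is the product of \<open>A - \<theta> (i + m)\<close> over \<open>m < n\<close> applied to \<open>v\<close>. On the component of \<open>v\<close>
  in the \<open>\<theta> j\<close>-eigenspace this product is a scalar, which is nonzero unless \<open>j\<close> lies in the range of
  the factors; so \<open>w n = 0\<close> forces every other component to vanish. Through this lemma a condition on powers of
  $R$ becomes membership in $K_i$.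
\<close>

lemma killed_by_factors:
  assumes "v \<in> flag i" and "w 0 = v" and "\<And>m. m < n \<Longrightarrow> w (Suc m) = A (w m) - scale (\<theta> (i + m)) (w m)"
    and "w n = 0" and "i + n \<le> Suc d"
  shows "v \<in> span (\<Union>j\<in>{i..<i + n}. eigenspace scale A (\<theta> j))"
proof -
  obtain P where lin: "\<And>j. j \<le> d \<Longrightarrow> endo (P j)"
    and P_in: "\<And>j v. j \<le> d \<Longrightarrow> P j v \<in> eigenspace scale A (\<theta> j)"
    and P_delta: "\<And>j l v. j \<le> d \<Longrightarrow> l \<le> d \<Longrightarrow> v \<in> eigenspace scale A (\<theta> l) \<Longrightarrow> P j v = (if j = l then v else 0)"
    and P_sum: "\<And>v. (\<Sum>j\<le>d. P j v) = v"
    using eigenprojections_exist[OF endo_A inj_\<theta> A_span] by blast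
  have P_A: "P j (A v) = scale (\<theta> j) (P j v)" if "j \<le> d" for j v
  proof (rule endo_eq_on_span[where X = "\<lambda>v. P j (A v)" and Y = "\<lambda>v. scale (\<theta> j) (P j v)", OF _ _ A_span])
    show "endo (\<lambda>v. P j (A v))" "endo (\<lambda>v. scale (\<theta> j) (P j v))"
      using lin[OF that] endo_A by (auto intro!: endoI simp: endo_simps algebra_simps)
    fix s assume "s \<in> (\<Union>j\<le>d. eigenspace scale A (\<theta> j))"
    then obtain l where l: "l \<le> d" "s \<in> eigenspace scale A (\<theta> l)" by auto
    then have "A s = scale (\<theta> l) s" by (simp add: eigenspace_iff)
    then show "P j (A s) = scale (\<theta> j) (P j s)"
      using P_delta[OF that l] lin[OF that] by (simp add: endo_simps)
  qed
  have P_w: "P j (w m) = scale (\<Prod>l<m. \<theta> j - \<theta> (i + l)) (P j v)" if "j \<le> d" "m \<le> n" for j m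
    using that(2)
    by (induction m)
      (simp_all add: assms(2,3) endo_simps[OF lin[OF that(1)]] P_A[OF that(1)] algebra_simps)
  have "P j v = 0" if "j \<le> d" "j \<notin> {i..<i + n}" for j
  proof (cases "j < i")
    case True
    have "P j v \<in> {0}"
    proof (rule endo_span_into[OF lin[OF that(1)] assms(1)[unfolded flag_def]])
      show "P j s \<in> {0}" if "s \<in> (\<Union>j\<in>{i..d}. eigenspace scale A (\<theta> j))" for s
        using that True P_delta[of j _ s] by auto
    qed (simp add: subspace_def)
    then show ?thesis by simp
  next
    case False
    with that have "\<theta> j - \<theta> (i + l) \<noteq> 0" if "l < n" for l
      using that assms(5) inj_onD[OF inj_\<theta>, of j "i + l"] by force
    then have "(\<Prod>l<n. \<theta> j - \<theta> (i + l)) \<noteq> 0" by simp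
    moreover have "scale (\<Prod>l<n. \<theta> j - \<theta> (i + l)) (P j v) = 0"
      using P_w[OF that(1), of n] assms(4) lin[OF that(1)] by (simp add: endo_simps)
    ultimately show ?thesis by simp
  qed
  then have "P j v \<in> span (\<Union>j\<in>{i..<i + n}. eigenspace scale A (\<theta> j))" if "j \<le> d" for j
    using P_in[OF that, of v] that by (cases "j \<in> {i..<i + n}") (auto intro!: span_base simp: span_zero)
  then have "(\<Sum>j\<le>d. P j v) \<in> span (\<Union>j\<in>{i..<i + n}. eigenspace scale A (\<theta> j))"
    by (intro span_sum) auto
  then show ?thesis by (simp add: P_sum)
qed

end

section \<open>Strings of weight vectors\<close>

text \<open>
  The abstract setting of a lowering operator $f = R$ and a weight operator $k = K$ of
  $U_q(\mathfrak{sl}_2)$, with weights $q^d, q^{d-2}, \dots, q^{-d}$. \<open>q\<close> may be a root of unity, but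
  only of an order so large that these weights are distinct.
\<close>

locale q_weight_spaces = linear_endos scale
  for scale :: "'k::field \<Rightarrow> 'v::ab_group_add \<Rightarrow> 'v" +
  fixes K Ki R :: "'v \<Rightarrow> 'v" and d :: nat and q :: 'k
  assumes endo_K: "endo K" and endo_Ki: "endo Ki" and endo_R: "endo R"
    and q_nonzero: "q \<noteq> 0"
    and q_order: "1 \<le> m \<Longrightarrow> m \<le> d \<Longrightarrow> q ^ (2 * m) \<noteq> 1"
    and Ki_K: "Ki (K v) = v"
    and weight_span: "span (\<Union>i\<le>d. eigenspace scale K (q powi (int d - 2 * int i))) = UNIV"
    and R_weight: "i < d \<Longrightarrow> K v = scale (q powi (int d - 2 * int i)) v \<Longrightarrow>
      K (R v) = scale (q powi (int d - 2 * int (Suc i))) (R v)"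
    and R_last: "K v = scale (q powi (int d - 2 * int d)) v \<Longrightarrow> R v = 0"
begin

definition wt :: "nat \<Rightarrow> 'k" where
  "wt i = q powi (int d - 2 * int i)"

definition U :: "nat \<Rightarrow> 'v set" where
  "U i = eigenspace scale K (wt i)"

lemma wt_nonzero: "wt i \<noteq> 0"
  using q_nonzero by (simp add: wt_def)

lemma wt_add: "wt (i + m) = wt i * inverse (q ^ (2 * m))"
proof -
  have "int d - 2 * int (i + m) = (int d - 2 * int i) - int (2 * m)" by simp
  then have "wt (i + m) = wt i / (q powi int (2 * m))"
    by (simp only: wt_def power_int_diff[OF disjI1[OF q_nonzero]])
  then show ?thesis unfolding power_int_of_nat by (simp add: field_simps)
qed

lemma q_powi_eq_1:
  assumes "q powi (2 * n) = 1" and "\<bar>n\<bar> \<le> int d"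
  shows "n = 0"
proof (rule ccontr)
  assume "n \<noteq> 0"
  have "q powi (2 * \<bar>n\<bar>) = 1"
    using assms(1) by (cases "n \<ge> 0") (simp_all add: power_int_minus)
  moreover have "2 * \<bar>n\<bar> = int (2 * nat \<bar>n\<bar>)" by simp
  ultimately have "q ^ (2 * nat \<bar>n\<bar>) = 1"
    by (metis power_int_of_nat)
  then show False
    using q_order[of "nat \<bar>n\<bar>"] assms(2) \<open>n \<noteq> 0\<close> by simp
qed

lemma inj_wt: "inj_on wt {..d}"
proof (rule inj_onI)
  fix i j assume ij: "i \<in> {..d}" "j \<in> {..d}" "wt i = wt j"
  have "q powi (2 * (int j - int i)) = q powi (int d - 2 * int i) / q powi (int d - 2 * int j)"
    using q_nonzero by (simp add: algebra_simps flip: power_int_diff)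
  then have "q powi (2 * (int j - int i)) = 1"
    using ij(3) wt_nonzero[of j] by (simp add: wt_def)
  then have "int j - int i = 0"
    by (rule q_powi_eq_1) (use ij in auto)
  then show "i = j" by simp
qed

lemma U_iff: "v \<in> U i \<longleftrightarrow> K v = scale (wt i) v"
  by (simp add: U_def eigenspace_iff)

lemma subspace_U: "subspace (U i)"
  unfolding U_def by (rule subspace_eigenspace[OF endo_K])

lemma U_span: "span (\<Union>i\<le>d. U i) = UNIV"
  using weight_span by (simp add: U_def wt_def)

lemma Ki_U: "v \<in> U i \<Longrightarrow> Ki v = scale (inverse (wt i)) v"
proof -
  assume "v \<in> U i"
  then have "v = scale (wt i) (Ki v)"
    using Ki_K[of v] endo_Ki by (simp add: U_iff endo_simps)
  then show ?thesis
    using wt_nonzero[of i] by (metis scale_scale left_inverse scale_one)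
qed

lemma R_U: "i < d \<Longrightarrow> v \<in> U i \<Longrightarrow> R v \<in> U (Suc i)"
  using R_weight by (simp add: U_iff wt_def)

lemma R_U_last: "v \<in> U d \<Longrightarrow> R v = 0"
  using R_last by (simp add: U_iff wt_def)

lemma R_power_U: "i + m \<le> d \<Longrightarrow> v \<in> U i \<Longrightarrow> (R ^^ m) v \<in> U (i + m)"
  by (induction m) (simp_all add: R_U)

lemma R_power_eq_0:
  assumes "i \<le> d" and "v \<in> U i"
  shows "(R ^^ (Suc (d - i))) v = 0"
  using R_power_U[of i "d - i" v] assms R_U_last by simp

lemma K_R_power: "i \<le> d \<Longrightarrow> v \<in> U i \<Longrightarrow> K ((R ^^ m) v) = scale (wt (i + m)) ((R ^^ m) v)"
  and Ki_R_power: "i \<le> d \<Longrightarrow> v \<in> U i \<Longrightarrow> Ki ((R ^^ m) v) = scale (inverse (wt (i + m))) ((R ^^ m) v)"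
proof -
  assume *: "i \<le> d" "v \<in> U i"
  have "(R ^^ m) v = 0" if "i + m > d"
  proof -
    have "m = (m - Suc (d - i)) + Suc (d - i)" using that * by simp
    then have "(R ^^ m) v = (R ^^ (m - Suc (d - i))) ((R ^^ (Suc (d - i))) v)"
      by (metis funpow_add comp_apply)
    also have "\<dots> = 0"
      unfolding R_power_eq_0[OF *] using endo_funpow[OF endo_R] by (simp add: endo_simps)
    finally show ?thesis .
  qed
  then have "(R ^^ m) v \<in> U (i + m)"
    using * R_power_U[of i m v] subspace_0[OF subspace_U[of "i + m"]] by (cases "i + m \<le> d") auto
  then show "K ((R ^^ m) v) = scale (wt (i + m)) ((R ^^ m) v)"
    "Ki ((R ^^ m) v) = scale (inverse (wt (i + m))) ((R ^^ m) v)"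
    by (simp_all add: U_iff Ki_U)
qed

text \<open>
  Up to scaling, \<open>T\<close> satisfies the relation that $U_q(\mathfrak{sl}_2)$ prescribes between $e$ and
  $f = R$. This property is shared by \<open>\<psi>\<close> and its component of degree $-1$, and the theory of strings
  is applied to both.
\<close>

definition q_commutator :: "('v \<Rightarrow> 'v) \<Rightarrow> bool" where
  "q_commutator T \<longleftrightarrow> endo T \<and> (\<forall>v. T (R v) - R (T v) = scale (q - inverse q) (K v - Ki v))"

text \<open>
  In terms of $q$-integers this is $(q - q^{-1})^2 [m] [d - 2i - m + 1]$. Up to the factor
  $(q - q^{-1})^2$ it is the scalar in $e f^m h = [m] [d - 2i - m + 1] f^{m-1} h$ for a highest weight vector $h$ of
  weight $q^{d-2i}$.
\<close>

definition string_coeff :: "nat \<Rightarrow> nat \<Rightarrow> 'k" where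
  "string_coeff i m = (q ^ m - inverse (q ^ m)) * (wt i * q * inverse (q ^ m) - inverse (wt i * q * inverse (q ^ m)))"

lemma string_coeff_0: "string_coeff i 0 = 0"
  by (simp add: string_coeff_def)

lemma string_coeff_Suc:
  "string_coeff i (Suc m) = string_coeff i m + (q - inverse q) * (wt (i + m) - inverse (wt (i + m)))"
proof -
  \<comment> \<open>With \<open>x = q ^ m\<close> and \<open>y = wt i\<close>, both sides are Laurent polynomials in \<open>q\<close>, \<open>x\<close>, \<open>y\<close>.\<close>
  have identity: "(q * x - inverse (q * x)) * (y * q * inverse (q * x) - inverse (y * q * inverse (q * x)))
     = (x - inverse x) * (y * q * inverse x - inverse (y * q * inverse x))
       + (q - inverse q) * (y * inverse (x * x) - inverse (y * inverse (x * x)))"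
    if "x \<noteq> 0" "y \<noteq> 0" for x y
    using that q_nonzero by (simp add: field_simps)
  have "q ^ (2 * m) = q ^ m * q ^ m" by (simp add: mult_2 power_add)
  then show ?thesis
    using identity[of "q ^ m" "wt i"] q_nonzero wt_nonzero[of i] by (simp add: string_coeff_def wt_add)
qed

lemma string_coeff_eq_0:
  assumes "i \<le> d" and "1 \<le> m" and "i + m \<le> Suc d" and "string_coeff i m = 0"
  shows "2 * i + m = Suc d"
proof -
  define z where "z = wt i * q * inverse (q ^ m)"
  have "q ^ m = inverse (q ^ m) \<or> z = inverse z"
    using assms(4) by (simp only: string_coeff_def z_def mult_eq_0_iff right_minus_eq)
  moreover have "q ^ m \<noteq> 0" "z \<noteq> 0"
    using q_nonzero wt_nonzero[of i] by (simp_all add: z_def)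
  ultimately have "q ^ m * q ^ m = 1 \<or> z * z = 1"
    by (metis right_inverse)
  then show ?thesis
  proof
    assume "q ^ m * q ^ m = 1"
    then have "q ^ (2 * m) = 1" by (simp add: mult_2 power_add)
    then have "\<not> m \<le> d" using q_order[OF assms(2)] by blast
    then show ?thesis using assms by simp
  next
    assume zz: "z * z = 1"
    let ?n = "int d - 2 * int i + 1 - int m"
    have "z = q powi ?n"
      unfolding z_def wt_def using q_nonzero by (simp add: power_int_add power_int_diff field_simps)
    then have "q powi (2 * ?n) = 1"
      using zz by (simp only: mult_2 power_int_add[OF disjI1[OF q_nonzero]])
    then have "?n = 0"
      by (intro q_powi_eq_1) (use assms in auto)
    then show ?thesis by simp
  qed
qed

text \<open>
  The usual hypothesis of the highest weight computation is $Th = 0$, but $RTh = 0$ is enough, since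
  $Th$ enters only after a further application of $R$. The weaker form is what makes the
  decomposition into strings work in the absence of complete reducibility.
\<close>

lemma q_commutator_string:
  assumes "q_commutator T" and "i \<le> d" and "h \<in> U i" and "R (T h) = 0"
  shows "T ((R ^^ Suc m) h) = scale (string_coeff i (Suc m)) ((R ^^ m) h)"
proof -
  have T_R: "T (R v) = R (T v) + scale (q - inverse q) (K v - Ki v)" for v
    using assms(1) by (simp add: q_commutator_def algebra_simps)
  have step: "T ((R ^^ Suc m) h) = scale (string_coeff i (Suc m)) ((R ^^ m) h)"
    if "R (T ((R ^^ m) h)) = scale (string_coeff i m) ((R ^^ m) h)" for m
    using that K_R_power[OF assms(2,3), of m] Ki_R_power[OF assms(2,3), of m]
    by (simp add: T_R string_coeff_Suc scale_left_distrib right_diff_distrib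
        flip: scale_left_diff_distrib)
  have "R (T ((R ^^ m) h)) = scale (string_coeff i m) ((R ^^ m) h)" for m
  proof (induction m)
    case 0
    then show ?case using assms(4) by (simp add: string_coeff_0)
  next
    case (Suc m)
    show ?case unfolding step[OF Suc] using endo_R by (simp add: endo_simps)
  qed
  then show ?thesis by (rule step)
qed

text \<open>
  Let $m$ be minimal with $R^m h = 0$. Applying $T$ shows that the coefficient for $m$ vanishes, and
  the restriction on the order of $q$ leaves $m = d - 2i + 1$ as the only possibility. In
  particular a nonzero $h$ cannot live in the second half of the weights.
\<close>

lemma q_commutator_string_length:
  assumes "q_commutator T" and "i \<le> d" and "h \<in> U i" and "R (T h) = 0" and "h \<noteq> 0"
  shows "2 * i \<le> d \<and> (R ^^ (d - 2 * i + 1)) h = 0"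
proof -
  define m where "m = (LEAST m. (R ^^ m) h = 0)"
  have "(R ^^ m) h = 0"
    unfolding m_def using R_power_eq_0[OF assms(2,3)] by (rule LeastI)
  moreover have "m \<le> Suc (d - i)"
    unfolding m_def using R_power_eq_0[OF assms(2,3)] by (rule Least_le)
  ultimately obtain l where l: "m = Suc l"
    using assms(5) by (cases m) auto
  then have "(R ^^ l) h \<noteq> 0"
    unfolding m_def using not_less_Least[of l "\<lambda>m. (R ^^ m) h = 0"] by simp
  moreover have "scale (string_coeff i m) ((R ^^ l) h) = 0"
    using q_commutator_string[OF assms(1-4), of l] \<open>(R ^^ m) h = 0\<close> assms(1) l
    by (simp add: q_commutator_def endo_simps)
  ultimately have "string_coeff i m = 0" by simp
  then have "2 * i + m = Suc d"
    using string_coeff_eq_0[of i m] assms(2) l \<open>m \<le> Suc (d - i)\<close> by simp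
  then have "2 * i \<le> d" "m = d - 2 * i + 1" using l by auto
  then show ?thesis using \<open>(R ^^ m) h = 0\<close> by simp
qed

text \<open>
  \<open>L\<close> is the component of \<open>\<psi>\<close> of degree $-1$ with respect to the grading by weight spaces. Since \<open>R\<close> has
  degree $1$ and $K - K^{-1}$ has degree $0$, the commutation relation only sees this component.
\<close>

lemma homogeneous_q_commutator:
  assumes "q_commutator \<psi>"
  obtains L where "q_commutator L" and "\<And>v. v \<in> U 0 \<Longrightarrow> L v = 0"
    and "\<And>i v. i < d \<Longrightarrow> v \<in> U (Suc i) \<Longrightarrow> L v \<in> U i"
proof -
  have endo_\<psi>: "endo \<psi>" using assms by (simp add: q_commutator_def)
  obtain P where lin: "\<And>i. i \<le> d \<Longrightarrow> endo (P i)"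
    and P_in: "\<And>i v. i \<le> d \<Longrightarrow> P i v \<in> U i"
    and P_delta: "\<And>i j v. i \<le> d \<Longrightarrow> j \<le> d \<Longrightarrow> v \<in> U j \<Longrightarrow> P i v = (if i = j then v else 0)"
    by (rule eigenprojections_exist[OF endo_K inj_wt U_span[unfolded U_def], folded U_def]) (rule that)
  have P_R_0: "P 0 (R v) = 0" for v
  proof (rule endo_eq_on_span[where X = "\<lambda>v. P 0 (R v)" and Y = "\<lambda>v. 0", OF _ _ U_span])
    show "endo (\<lambda>v. P 0 (R v))" "endo (\<lambda>v. 0)"
      using endo_R lin by (auto intro!: endoI simp: endo_simps)
    fix s assume "s \<in> (\<Union>i\<le>d. U i)"
    then obtain j where j: "j \<le> d" "s \<in> U j" by auto
    then show "P 0 (R s) = 0"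
      using R_U[of j s] R_U_last[of s] P_delta[of 0 "Suc j" "R s"] lin[of 0]
      by (cases "j = d") (auto simp: endo_simps)
  qed
  have P_R_Suc: "P (Suc i) (R v) = R (P i v)" if "i < d" for i v
  proof (rule endo_eq_on_span[where X = "\<lambda>v. P (Suc i) (R v)" and Y = "\<lambda>v. R (P i v)", OF _ _ U_span])
    have "endo (P i)" "endo (P (Suc i))" using that by (simp_all add: lin)
    then show "endo (\<lambda>v. P (Suc i) (R v))" "endo (\<lambda>v. R (P i v))"
      using endo_R by (auto intro!: endoI simp: endo_simps)
    fix s assume "s \<in> (\<Union>i\<le>d. U i)"
    then obtain j where j: "j \<le> d" "s \<in> U j" by auto
    show "P (Suc i) (R s) = R (P i s)"
    proof (cases "j = d")
      case True
      then show ?thesis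
        using j that R_U_last[of s] P_delta[of i j s] endo_R \<open>endo (P (Suc i))\<close>
        by (auto simp: endo_simps)
    next
      case False
      then show ?thesis
        using j that R_U[of j s] P_delta[of i j s] P_delta[of "Suc i" "Suc j" "R s"] endo_R
        by (auto simp: endo_simps)
    qed
  qed
  define L where "L = (\<lambda>v. \<Sum>i<d. P i (\<psi> (P (Suc i) v)))"
  have endo_L: "endo L"
    unfolding L_def by (rule endoI) (simp_all add: endo_simps[OF lin] endo_simps[OF endo_\<psi>] sum.distrib scale_sum_right)
  have L_0: "L v = 0" if "v \<in> U 0" for v
    unfolding L_def using that
    by (intro sum.neutral) (auto simp: P_delta[of _ 0 v] endo_simps[OF lin] endo_simps[OF endo_\<psi>])
  have L_Suc: "L v = P j (\<psi> v)" if "j < d" "v \<in> U (Suc j)" for j v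
  proof -
    have "L v = (\<Sum>i<d. if i = j then P j (\<psi> v) else 0)"
      unfolding L_def using that
      by (intro sum.cong) (auto simp: P_delta[of _ "Suc j" v] endo_simps[OF lin] endo_simps[OF endo_\<psi>])
    then show ?thesis using that by simp
  qed
  have "L (R v) - R (L v) = scale (q - inverse q) (K v - Ki v)" for v
  proof (rule endo_eq_on_span[where X = "\<lambda>v. L (R v) - R (L v)"
        and Y = "\<lambda>v. scale (q - inverse q) (K v - Ki v)", OF _ _ U_span])
    show "endo (\<lambda>v. L (R v) - R (L v))" "endo (\<lambda>v. scale (q - inverse q) (K v - Ki v))"
      using endo_L endo_R endo_K endo_Ki by (auto intro!: endoI simp: endo_simps algebra_simps)
    fix s assume "s \<in> (\<Union>i\<le>d. U i)"
    then obtain j where j: "j \<le> d" "s \<in> U j" by auto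
    have "L (R s) = P j (\<psi> (R s))"
    proof (cases "j = d")
      case True
      then show ?thesis
        using j R_U_last endo_L endo_\<psi> lin[of j] by (simp add: endo_simps)
    next
      case False
      then show ?thesis using j R_U L_Suc by simp
    qed
    moreover have "R (L s) = P j (R (\<psi> s))"
    proof (cases j)
      case 0
      then show ?thesis using j endo_R by (simp add: L_0 P_R_0 endo_simps)
    next
      case (Suc n)
      then show ?thesis using j L_Suc[of n s] by (simp add: P_R_Suc)
    qed
    ultimately have "L (R s) - R (L s) = P j (\<psi> (R s) - R (\<psi> s))"
      using lin[OF j(1)] by (simp add: endo_simps)
    also have "\<dots> = P j (scale (q - inverse q) (K s - Ki s))"
      using assms by (simp add: q_commutator_def)
    also have "\<dots> = scale (q - inverse q) (K s - Ki s)"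
      using j Ki_U[OF j(2)] lin[OF j(1)] by (simp add: U_iff P_delta endo_simps)
    finally show "L (R s) - R (L s) = scale (q - inverse q) (K s - Ki s)" .
  qed
  then have "q_commutator L" using endo_L by (simp add: q_commutator_def)
  then show ?thesis using that L_0 L_Suc P_in by simp
qed

text \<open>
  The vectors $h$ are those from which a string of the full length $d - 2i + 1$ starts. They are found
  by means of \<open>L\<close>, as the vectors with $RLh = 0$ (the sets \<open>H i\<close> below), and it is shown by induction
  on the weight that their strings span. For $u \in U_{i+1}$ the vector $Lu$ is a sum of elements of
  strings, and one looks for a sum $w$ of elements of the same strings with $Lu = Lw$. This is
  possible unless an element that occurs in $Lu$ is the end of its string, in which case $R$ kills it.
  Hence $w$ can always be chosen with $RLu = RLw$, so that $u - w$ is a new starting vector.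
\<close>

lemma strings_span:
  assumes "q_commutator \<psi>"
  shows "span (\<Union>i\<in>{i. 2 * i \<le> d}. \<Union>m. (R ^^ m) ` {h \<in> U i. (R ^^ (d - 2 * i + 1)) h = 0}) = UNIV"
    (is "span ?strings = _")
proof -
  obtain L where L: "q_commutator L" and L_0: "\<And>v. v \<in> U 0 \<Longrightarrow> L v = 0"
    and L_Suc: "\<And>i v. i < d \<Longrightarrow> v \<in> U (Suc i) \<Longrightarrow> L v \<in> U i"
    using homogeneous_q_commutator[OF assms] by blast
  have endo_L: "endo L" using L by (simp add: q_commutator_def)
  define H where "H i = {h \<in> U i. R (L h) = 0}" for i
  define S where "S i = span (\<Union>j\<in>{..i}. (R ^^ (i - j)) ` H j)" for i
  have S_U: "S i \<subseteq> U i" if "i \<le> d" for i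
    unfolding S_def
  proof (rule span_minimal)
    show "(\<Union>j\<in>{..i}. (R ^^ (i - j)) ` H j) \<subseteq> U i"
    proof (intro UN_least image_subsetI)
      fix j h assume "j \<in> {..i}" "h \<in> H j"
      then show "(R ^^ (i - j)) h \<in> U i"
        using R_power_U[of j "i - j" h] that by (simp add: H_def)
    qed
  qed (rule subspace_U)
  have lift: "\<exists>w\<in>S (Suc i). R x = R (L w)" if "Suc i \<le> d" "x \<in> S i" for i x
  proof -
    have "subspace (S (Suc i))" by (simp add: S_def)
    have "subspace {x. \<exists>w\<in>S (Suc i). R x = R (L w)}"
    proof (rule subspaceI; clarify)
      show "\<exists>w\<in>S (Suc i). R 0 = R (L w)"
        using subspace_0[OF \<open>subspace (S (Suc i))\<close>] endo_L by (intro bexI[of _ 0]) (simp_all add: endo_simps)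
    next
      fix x y v w assume "v \<in> S (Suc i)" "R x = R (L v)" "w \<in> S (Suc i)" "R y = R (L w)"
      then show "\<exists>w\<in>S (Suc i). R (x + y) = R (L w)"
        using subspace_add[OF \<open>subspace (S (Suc i))\<close>] endo_L endo_R
        by (intro bexI[of _ "v + w"]) (simp_all add: endo_simps)
    next
      fix c x w assume "w \<in> S (Suc i)" "R x = R (L w)"
      then show "\<exists>w\<in>S (Suc i). R (scale c x) = R (L w)"
        using subspace_scale[OF \<open>subspace (S (Suc i))\<close>] endo_L endo_R
        by (intro bexI[of _ "scale c w"]) (simp_all add: endo_simps)
    qed
    moreover have "(\<Union>j\<in>{..i}. (R ^^ (i - j)) ` H j) \<subseteq> {x. \<exists>w\<in>S (Suc i). R x = R (L w)}"
    proof (intro UN_least image_subsetI CollectI)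
      fix j h assume j: "j \<in> {..i}" and h: "h \<in> H j"
      let ?c = "string_coeff j (Suc (i - j))"
      let ?w = "(R ^^ Suc (i - j)) h"
      have hU: "h \<in> U j" "R (L h) = 0" and jd: "j \<le> d"
        using h j that by (auto simp: H_def)
      have "Suc i - j = Suc (i - j)" using j by (simp add: Suc_diff_le)
      then have w: "?w \<in> S (Suc i)"
        unfolding S_def using j h by (intro span_base) (auto intro!: bexI[of _ j])
      show "\<exists>w\<in>S (Suc i). R ((R ^^ (i - j)) h) = R (L w)"
      \<comment> \<open>If \<open>?c = 0\<close>, then \<open>(R ^^ (i - j)) h\<close> is the end of its string and \<open>R\<close> kills it.\<close>
      proof (cases "?c = 0")
        case False
        have "L (scale (inverse ?c) ?w) = (R ^^ (i - j)) h"
          using q_commutator_string[OF L jd hU, of "i - j"] endo_L False by (simp add: endo_simps)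
        then show ?thesis
          using w subspace_scale[OF \<open>subspace (S (Suc i))\<close>, of ?w]
          by (intro bexI[of _ "scale (inverse ?c) ?w"]) simp_all
      next
        case True
        then have "2 * j + Suc (i - j) = Suc d"
          using string_coeff_eq_0[OF jd _ _ True] j that by simp
        then have "Suc (i - j) = d - 2 * j + 1" by simp
        moreover have "(R ^^ (d - 2 * j + 1)) h = 0"
          using q_commutator_string_length[OF L jd hU] endo_funpow[OF endo_R, of "d - 2 * j + 1"]
          by (cases "h = 0") (auto simp only: endo_simps)
        ultimately have "R ((R ^^ (i - j)) h) = 0" by simp
        then show ?thesis
          using subspace_0[OF \<open>subspace (S (Suc i))\<close>] endo_L endo_R
          by (intro bexI[of _ 0]) (simp_all add: endo_simps)
      qed
    qed
    ultimately have "S i \<subseteq> {x. \<exists>w\<in>S (Suc i). R x = R (L w)}"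
      unfolding S_def[of i] by (intro span_minimal)
    then show ?thesis using that(2) by blast
  qed
  have H_S: "H i \<subseteq> S i" for i
    unfolding S_def by (rule order_trans[OF _ span_superset]) force
  have U_S: "U i \<subseteq> S i" if "i \<le> d" for i
    using that
  proof (induction i)
    case 0
    have "U 0 \<subseteq> H 0" using L_0 endo_R by (auto simp: H_def endo_simps)
    then show ?case using H_S by blast
  next
    case (Suc i)
    show ?case
    proof
      fix u assume u: "u \<in> U (Suc i)"
      then have "L u \<in> S i" using Suc L_Suc by auto
      then obtain w where w: "w \<in> S (Suc i)" "R (L u) = R (L w)"
        using lift[OF Suc.prems] by blast
      then have "u - w \<in> U (Suc i)"
        using u S_U[OF Suc.prems] subspace_diff[OF subspace_U] by blast
      then have "u - w \<in> H (Suc i)"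
        using w(2) endo_L endo_R by (simp add: H_def endo_simps)
      then have "(u - w) + w \<in> S (Suc i)"
        using H_S w(1) unfolding S_def by (intro span_add) auto
      then show "u \<in> S (Suc i)" by simp
    qed
  qed
  have string_in: "(R ^^ m) h \<in> span ?strings" if "j \<le> d" "h \<in> H j" for j m h
  proof (cases "h = 0")
    case True
    then show ?thesis using endo_funpow[OF endo_R, of m] by (simp add: endo_simps span_zero)
  next
    case False
    then have "2 * j \<le> d \<and> (R ^^ (d - 2 * j + 1)) h = 0"
      using q_commutator_string_length[OF L that(1), of h] that(2) by (simp add: H_def)
    then show ?thesis using that(2) by (intro span_base) (auto simp: H_def)
  qed
  then have "S i \<subseteq> span ?strings" if "i \<le> d" for i
    unfolding S_def
  proof (intro span_minimal UN_least image_subsetI)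
    fix j h assume "j \<in> {..i}" "h \<in> H j"
    then show "(R ^^ (i - j)) h \<in> span ?strings"
      using that by (intro string_in) auto
  qed simp
  then have "span (\<Union>i\<le>d. U i) \<subseteq> span ?strings"
    using U_S by (intro span_minimal UN_least) (auto intro: order_trans)
  then show ?thesis unfolding U_span by blast
qed

text \<open>
  By hypothesis \<open>\<psi>\<close> kills the starting vectors of the strings that span by the preceding lemma. On
  such a string \<open>\<psi>\<close> steps back by one place, up to a scalar, and so multiplies the weight by $q^2$.
\<close>

theorem K_q_commutator:
  assumes "q_commutator \<psi>"
    and kills: "\<And>i h. 2 * i \<le> d \<Longrightarrow> h \<in> U i \<Longrightarrow> (R ^^ (d - 2 * i + 1)) h = 0 \<Longrightarrow> \<psi> h = 0"
  shows "K (\<psi> v) = scale (q ^ 2) (\<psi> (K v))"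
proof (rule endo_eq_on_span[where X = "\<lambda>v. K (\<psi> v)" and Y = "\<lambda>v. scale (q ^ 2) (\<psi> (K v))",
      OF _ _ strings_span[OF assms(1)]])
  have endo_\<psi>: "endo \<psi>" using assms(1) by (simp add: q_commutator_def)
  then show "endo (\<lambda>v. K (\<psi> v))" "endo (\<lambda>v. scale (q ^ 2) (\<psi> (K v)))"
    using endo_K by (auto intro!: endoI simp: endo_simps algebra_simps)
  fix s assume "s \<in> (\<Union>i\<in>{i. 2 * i \<le> d}. \<Union>m. (R ^^ m) ` {h \<in> U i. (R ^^ (d - 2 * i + 1)) h = 0})"
  then obtain i m h where i: "2 * i \<le> d" and h: "h \<in> U i" "(R ^^ (d - 2 * i + 1)) h = 0"
    and s: "s = (R ^^ m) h" by auto
  have \<psi>h: "\<psi> h = 0" using kills i h by blast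
  have id: "i \<le> d" using i by simp
  have Ks: "K s = scale (wt (i + m)) s" unfolding s using K_R_power[OF id h(1)] .
  show "K (\<psi> s) = scale (q ^ 2) (\<psi> (K s))"
  proof (cases m)
    case 0
    then show ?thesis
      using Ks \<psi>h s endo_\<psi> endo_K by (simp add: endo_simps)
  next
    case (Suc l)
    have \<psi>s: "\<psi> s = scale (string_coeff i (Suc l)) ((R ^^ l) h)"
      unfolding s Suc using q_commutator_string[OF assms(1) id h(1)] \<psi>h endo_R by (simp add: endo_simps)
    have "wt (i + l) = q ^ 2 * wt (i + m)"
      using wt_add[of "i + l" 1] Suc q_nonzero by (simp add: power2_eq_square field_simps)
    then show ?thesis
      unfolding Ks using \<psi>s K_R_power[OF id h(1), of l] endo_\<psi> endo_K
      by (simp add: endo_simps mult.commute)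
  qed
qed

lemma K_R: "K (R v) = scale (inverse q ^ 2) (R (K v))"
proof (rule endo_eq_on_span[where X = "\<lambda>v. K (R v)" and Y = "\<lambda>v. scale (inverse q ^ 2) (R (K v))",
      OF _ _ U_span])
  show "endo (\<lambda>v. K (R v))" "endo (\<lambda>v. scale (inverse q ^ 2) (R (K v)))"
    using endo_K endo_R by (auto intro!: endoI simp: endo_simps algebra_simps)
  fix s assume "s \<in> (\<Union>i\<le>d. U i)"
  then obtain i where i: "i \<le> d" "s \<in> U i" by auto
  then show "K (R s) = scale (inverse q ^ 2) (R (K s))"
    using K_R_power[OF i, of 1] wt_add[of i 1] endo_R
    by (simp add: U_iff endo_simps power_inverse mult.commute)
qed

end

section \<open>Modules from operators that satisfy the defining relations\<close>

lemma free_alg_induct [case_names zero add]: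
  fixes p :: "'w \<Rightarrow>\<^sub>0 'k::field"
  assumes "P 0" and "\<And>w c p. P p \<Longrightarrow> P (Poly_Mapping.single w c + p)"
  shows "P p"
proof (induction p rule: update_induct)
  case const
  show ?case by (rule assms(1))
next
  case (update p w c)
  have "Poly_Mapping.update w c p = Poly_Mapping.single w c + p"
    using update(1) by (intro poly_mapping_eqI) (auto simp: lookup_update lookup_add lookup_single in_keys_iff when_def)
  then show ?case using assms(2) update(3) by simp
qed

text \<open>
  Operators that satisfy the defining relations of $U_q(\mathfrak{sl}_2)$; evaluating words in them
  makes \<open>'v\<close> a module.
\<close>

locale Uq_operators = linear_endos scale
  for scale :: "'k::field \<Rightarrow> 'v::ab_group_add \<Rightarrow> 'v" +
  fixes e f k ki :: "'v \<Rightarrow> 'v" and q :: 'k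
  assumes endo_e: "endo e" and endo_f: "endo f" and endo_k: "endo k" and endo_ki: "endo ki"
    and k_ki: "k (ki v) = v" and ki_k: "ki (k v) = v"
    and k_e_ki: "k (e (ki v)) = scale (q ^ 2) (e v)"
    and k_f_ki: "k (f (ki v)) = scale (inverse q ^ 2) (f v)"
    and e_f: "e (f v) - f (e v) = scale (inverse (q - inverse q)) (k v - ki v)"
begin

definition gen_op :: "chev \<Rightarrow> 'v \<Rightarrow> 'v" where
  "gen_op x = (case x of Gen_e \<Rightarrow> e | Gen_f \<Rightarrow> f | Gen_k \<Rightarrow> k | Gen_ki \<Rightarrow> ki)"

definition word_op :: "chev free_word \<Rightarrow> 'v \<Rightarrow> 'v" where
  "word_op w = foldr gen_op (letters w)"

definition evaluate :: "(chev free_word \<Rightarrow>\<^sub>0 'k) \<Rightarrow> 'v \<Rightarrow> 'v" where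
  "evaluate p v = (\<Sum>w\<in>Poly_Mapping.keys p. scale (Poly_Mapping.lookup p w) (word_op w v))"

lemma endo_gen_op: "endo (gen_op x)"
  by (cases x) (simp_all add: gen_op_def endo_e endo_f endo_k endo_ki)

lemma endo_word_op: "endo (word_op w)"
proof -
  have "endo (foldr gen_op xs)" for xs
    by (induction xs) (auto intro!: endoI simp: endo_simps endo_simps[OF endo_gen_op])
  then show ?thesis by (simp add: word_op_def)
qed

lemma word_op_add: "word_op (u + w) v = word_op u (word_op w v)"
  by (simp add: word_op_def plus_free_word_def)

lemma evaluate_add: "evaluate (p + r) v = evaluate p v + evaluate r v"
  unfolding evaluate_def by (rule setsum_keys_plus_distrib) (simp_all add: scale_left_distrib)

lemma evaluate_0: "evaluate 0 v = 0"
  by (simp add: evaluate_def)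

lemma evaluate_diff: "evaluate (p - r) v = evaluate p v - evaluate r v"
  using evaluate_add[of "p - r" r v] by (simp add: algebra_simps)

lemma evaluate_single: "evaluate (Poly_Mapping.single w c) v = scale c (word_op w v)"
  by (simp add: evaluate_def)

lemma evaluate_1: "evaluate 1 v = v"
  unfolding single_one[symmetric]
  by (simp add: evaluate_single word_op_def zero_free_word_def)

lemma endo_evaluate: "endo (evaluate p)"
  unfolding evaluate_def
  by (rule endoI) (simp_all add: endo_simps[OF endo_word_op] scale_right_distrib sum.distrib scale_sum_right mult.commute)

lemma evaluate_mult: "evaluate (p * r) v = evaluate p (evaluate r v)"
proof (induction p rule: free_alg_induct)
  case zero
  show ?case by (simp add: evaluate_0)
next
  case (add w c p)
  have "evaluate (Poly_Mapping.single w c * r) v = scale c (word_op w (evaluate r v))"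
    by (induction r rule: free_alg_induct)
      (simp_all add: evaluate_0 distrib_left evaluate_add mult_single evaluate_single word_op_add
        endo_simps[OF endo_word_op] scale_right_distrib)
  then show ?case using add by (simp add: distrib_right evaluate_add evaluate_single)
qed

lemma evaluate_gen: "evaluate (free_gen x) v = gen_op x v"
  by (simp add: free_gen_def evaluate_single word_op_def)

lemma evaluate_const: "evaluate (free_const c) v = scale c v"
  by (simp add: free_const_def evaluate_single word_op_def zero_free_word_def)

text \<open>
  The elements that act as zero form a two-sided ideal that contains the relators.
\<close>

lemma evaluate_ideal:
  assumes "p \<in> Uq_ideal q"
  shows "evaluate p v = 0"
proof -
  let ?N = "{p. \<forall>v. evaluate p v = 0}"
  have "ideal ?N free_alg"
  proof (rule idealI[OF ring_free_alg])
    have inv: "inv\<^bsub>add_monoid free_alg\<^esub> p = - p" for p :: "chev free_word \<Rightarrow>\<^sub>0 'k"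
    proof -
      have "ring (free_alg :: (chev free_word \<Rightarrow>\<^sub>0 'k) ring)" by (rule ring_free_alg)
      then interpret F: ring "free_alg :: (chev free_word \<Rightarrow>\<^sub>0 'k) ring" .
      have "\<ominus>\<^bsub>free_alg\<^esub> p = - p"
        by (rule F.minus_equality) (simp_all add: free_alg_def)
      then show ?thesis by (simp add: a_inv_def)
    qed
    show "subgroup ?N (add_monoid free_alg)"
    proof (rule subgroup.intro)
      show "inv\<^bsub>add_monoid free_alg\<^esub> p \<in> ?N" if "p \<in> ?N" for p
        unfolding inv using that evaluate_diff[of 0 p] by (simp add: evaluate_0)
    qed (auto simp: free_alg_def evaluate_add evaluate_0)
  qed (auto simp: free_alg_def evaluate_mult endo_simps[OF endo_evaluate])
  moreover have "Uq_relators q \<subseteq> ?N"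
    unfolding Uq_relators_def Let_def
    by (auto simp: evaluate_diff evaluate_mult evaluate_gen evaluate_const evaluate_1 gen_op_def
        k_ki ki_k k_e_ki k_f_ki e_f)
  ultimately have "Uq_ideal q \<subseteq> ?N"
    unfolding Uq_ideal_def by (rule ring.genideal_minimal[OF ring_free_alg])
  then show ?thesis using assms by blast
qed

text \<open>
  Any representative of the class will do, because the elements of the ideal act as zero.
\<close>

definition act :: "(chev free_word \<Rightarrow>\<^sub>0 'k) set \<Rightarrow> 'v \<Rightarrow> 'v" where
  "act C = evaluate (SOME p. p \<in> C)"

lemma act_class: "act (Uq_class q p) v = evaluate p v"
proof -
  have cls: "Uq_class q p = {r + p | r. r \<in> Uq_ideal q}"
    by (auto simp: Uq_class_def a_r_coset_def' free_alg_def)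
  interpret ideal "Uq_ideal q" free_alg by (rule ideal_Uq_ideal)
  have "0 \<in> Uq_ideal q"
    using additive_subgroup.zero_closed[OF additive_subgroup_axioms] by (simp add: free_alg_def)
  then have "p \<in> Uq_class q p"
    unfolding cls by force
  then have "(SOME p'. p' \<in> Uq_class q p) \<in> Uq_class q p" by (rule someI)
  then obtain r where "r \<in> Uq_ideal q" "(SOME p'. p' \<in> Uq_class q p) = r + p"
    unfolding cls by blast
  then show ?thesis by (simp add: act_def evaluate_add evaluate_ideal)
qed

theorem Uq_module_act: "Uq_module q scale act"
proof -
  interpret I: ideal "Uq_ideal q" free_alg by (rule ideal_Uq_ideal)
  have add: "Uq_class q x \<oplus>\<^bsub>Uq q\<^esub> Uq_class q y = Uq_class q (x + y)"
    and mult: "Uq_class q x \<otimes>\<^bsub>Uq q\<^esub> Uq_class q y = Uq_class q (x * y)" for x y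
    using ring_hom_add[OF I.rcos_ring_hom, of x y] ring_hom_mult[OF I.rcos_ring_hom, of x y]
    by (simp_all add: Uq_class_def Uq_def) (simp_all add: free_alg_def)
  have one: "\<one>\<^bsub>Uq q\<^esub> = Uq_class q 1"
    using ring_hom_one[OF I.rcos_ring_hom] by (simp add: Uq_class_def Uq_def) (simp add: free_alg_def)
  have carrier: "\<exists>x. C = Uq_class q x" if "C \<in> carrier (Uq q)" for C
    using that by (auto simp: Uq_def Uq_class_def FactRing_def A_RCOSETS_def' a_r_coset_def')
  show ?thesis
    unfolding Uq_module_def
    by (auto dest!: carrier simp: add mult one act_class evaluate_add evaluate_mult evaluate_1
        evaluate_const endo_simps[OF endo_evaluate])
qed

lemma act_gen: "act (Uq_gen q x) v = gen_op x v"
  by (simp add: Uq_gen_def act_class evaluate_gen)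

end

section \<open>The module structure on a tridiagonal system of $q$-Racah type\<close>

text \<open>
  This reconciles eigenvalues, which are attached to the range of an idempotent, with standard
  orderings, which list eigenspaces.
\<close>

lemma (in linear_endos) range_primitive_idempotent:
  assumes "endo X" and "diagonalizable scale X" and "primitive_idempotent scale X W P"
  shows "range P = W"
proof
  have P: "endo P" "\<And>w. w \<in> W \<Longrightarrow> P w = w"
    "\<And>w. w \<in> span (\<Union>(eigenspaces scale X - {W})) \<Longrightarrow> P w = 0"
    using assms(3) by (auto simp: primitive_idempotent_def)
  obtain t where W: "W = eigenspace scale X t"
    using assms(3) by (auto simp: primitive_idempotent_def eigenspaces_def)
  have sub: "subspace W"
    unfolding W by (rule subspace_eigenspace[OF assms(1)])
  have "P v \<in> W" for v
  proof (rule endo_span_into[OF P(1) _ _ sub])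
    show "v \<in> span (\<Union>(eigenspaces scale X))"
      using assms(2) by (simp add: diagonalizable_def)
    fix s assume "s \<in> \<Union>(eigenspaces scale X)"
    then have "s \<in> W \<or> s \<in> span (\<Union>(eigenspaces scale X - {W}))"
      by (blast intro: span_base)
    then show "P s \<in> W"
      using P(2,3) subspace_0[OF sub] by auto
  qed
  then show "range P \<subseteq> W" by blast
  show "W \<subseteq> range P"
    using P(2) by (metis rangeI subsetI)
qed

lemma (in linear_endos) standard_ordering_eigenvalues:
  assumes "endo X" and "diagonalizable scale X" and "standard_ordering scale X Y d W"
    and "\<And>i. i \<le> d \<Longrightarrow> primitive_idempotent scale X (W i) (E i)"
    and "\<And>i. i \<le> d \<Longrightarrow> eigenvalue_for scale X (E i) (\<theta> i)"
  shows "inj_on \<theta> {..d}"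
    and "span (\<Union>j\<le>d. eigenspace scale X (\<theta> j)) = UNIV"
    and "i \<le> d \<Longrightarrow> eigenspace scale X (\<theta> i) \<noteq> {0}"
    and "i \<le> d \<Longrightarrow> v \<in> eigenspace scale X (\<theta> i) \<Longrightarrow>
      Y v \<in> span (\<Union>j\<in>{j. j \<le> d \<and> i \<le> j + 1 \<and> j \<le> i + 1}. eigenspace scale X (\<theta> j))"
proof -
  have W: "W i = eigenspace scale X (\<theta> i)" if "i \<le> d" for i
    using range_primitive_idempotent[OF assms(1,2) assms(4)[OF that]] assms(5)[OF that]
    by (simp add: eigenvalue_for_def)
  have bij: "bij_betw W {..d} (eigenspaces scale X)"
    using assms(3) by (simp add: standard_ordering_def)
  show "inj_on \<theta> {..d}"
    using bij W unfolding bij_betw_def inj_on_def by (metis atMost_iff)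
  have "(\<Union>j\<le>d. eigenspace scale X (\<theta> j)) = \<Union>(W ` {..d})"
    using W by auto
  also have "\<dots> = \<Union>(eigenspaces scale X)"
    using bij by (simp add: bij_betw_def)
  finally show "span (\<Union>j\<le>d. eigenspace scale X (\<theta> j)) = UNIV"
    using assms(2) by (simp add: diagonalizable_def)
  show "eigenspace scale X (\<theta> i) \<noteq> {0}" if "i \<le> d"
  proof -
    have "W i \<in> eigenspaces scale X" using bij that by (auto simp: bij_betw_def)
    then show ?thesis using W[OF that] by (auto simp: eigenspaces_def)
  qed
  assume i: "i \<le> d" "v \<in> eigenspace scale X (\<theta> i)"
  have "Y v \<in> span (\<Union>j\<in>{j. j \<le> d \<and> i \<le> j + 1 \<and> j \<le> i + 1}. W j)"
    using assms(3) i W[OF i(1)] unfolding standard_ordering_def by blast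
  also have "(\<Union>j\<in>{j. j \<le> d \<and> i \<le> j + 1 \<and> j \<le> i + 1}. W j)
    = (\<Union>j\<in>{j. j \<le> d \<and> i \<le> j + 1 \<and> j \<le> i + 1}. eigenspace scale X (\<theta> j))"
    using W by (intro SUP_cong) auto
  finally show "Y v \<in> span (\<Union>j\<in>{j. j \<le> d \<and> i \<le> j + 1 \<and> j \<le> i + 1}. eigenspace scale X (\<theta> j))" .
qed

lemma TD_system_tridiagonal_system:
  assumes "vector_space scale" and "TD_system scale d A E As Es"
    and "\<And>i. i \<le> d \<Longrightarrow> eigenvalue_for scale A (E i) (\<theta> i)"
    and "\<And>i. i \<le> d \<Longrightarrow> eigenvalue_for scale As (Es i) (\<phi> i)"
  shows "tridiagonal_system scale A As d \<theta> \<phi>"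
proof -
  interpret linear_endos scale using assms(1) by (rule linear_endos.intro)
  have pair: "TD_pair scale A As" using assms(2) by (simp add: TD_system_def)
  then have endos: "endo A" "endo As" and diag: "diagonalizable scale A" "diagonalizable scale As"
    by (simp_all add: TD_pair_def)
  obtain W where W: "standard_ordering scale A As d W" "\<And>i. i \<le> d \<Longrightarrow> primitive_idempotent scale A (W i) (E i)"
    using assms(2) by (auto simp: TD_system_def)
  obtain Ws where Ws: "standard_ordering scale As A d Ws" "\<And>i. i \<le> d \<Longrightarrow> primitive_idempotent scale As (Ws i) (Es i)"
    using assms(2) by (auto simp: TD_system_def)
  note A_facts = standard_ordering_eigenvalues[OF endos(1) diag(1) W assms(3)]
  note As_facts = standard_ordering_eigenvalues[OF endos(2) diag(2) Ws assms(4)]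
  show ?thesis
  proof (intro tridiagonal_system.intro tridiagonal_system_axioms.intro linear_endos.intro)
    show "W = {0} \<or> W = UNIV" if "subspace W" "A ` W \<subseteq> W" "As ` W \<subseteq> W" for W
      using pair that by (auto simp: TD_pair_def)
  qed (use assms(1) endos A_facts As_facts in auto)
qed

theorem lemma7p1:
  fixes scale :: "'k::alg_closed_field \<Rightarrow> 'v::ab_group_add \<Rightarrow> 'v"
    and Basis :: "'v set"
    and A As K R \<psi> :: "'v \<Rightarrow> 'v"
    and E Es :: "nat \<Rightarrow> 'v \<Rightarrow> 'v"
    and d :: nat
    and q a b :: 'k
  assumes "finite_dimensional_vector_space scale Basis"
    and "(UNIV :: 'v set) \<noteq> {0}"
    and "d \<ge> 1"
    and "TD_system scale d A E As Es"
    and "q_Racah_type scale d A E As Es q a b"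
    and "is_K_map scale d E Es q K"
    and "R = R_map scale a A K"
    and "is_psi_map scale d E Es q K R \<psi>"
  shows "\<exists>act. Uq_module q scale act \<and>
           (\<forall>v. act (Uq_gen q Gen_e) v = scale (inverse (q - inverse q)) (\<psi> v)) \<and>
           (\<forall>v. act (Uq_gen q Gen_f) v = scale (inverse (q - inverse q)) (R v)) \<and>
           (\<forall>v. act (Uq_gen q Gen_k) v = K v) \<and>
           (\<forall>v. act (Uq_gen q Gen_ki) v = inv_into UNIV K v)"
proof -
  define \<theta> where "\<theta> i = a * q powi (int d - 2 * int i) + inverse a * q powi (2 * int i - int d)" for i
  define \<phi> where "\<phi> i = b * q powi (int d - 2 * int i) + inverse b * q powi (2 * int i - int d)" for i
  define \<kappa> where "\<kappa> i = q powi (int d - 2 * int i)" for i :: nat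
  define Ki where "Ki = inv_into UNIV K"
  have q: "q \<noteq> 0" "q ^ 4 \<noteq> 1"
    and ev: "\<And>i. i \<le> d \<Longrightarrow> eigenvalue_for scale A (E i) (\<theta> i)"
      "\<And>i. i \<le> d \<Longrightarrow> eigenvalue_for scale As (Es i) (\<phi> i)"
    using assms(5) by (simp_all add: q_Racah_type_def \<theta>_def \<phi>_def)
  have "vector_space scale"
    using assms(1) by (rule finite_dimensional_vector_space.axioms)
  then interpret tridiagonal_system scale A As d \<theta> \<phi>
    using assms(4) ev by (rule TD_system_tridiagonal_system)

  have dual_flag_eq: "span (\<Union>j\<in>{0..i}. range (Es j)) = dual_flag i" if "i \<le> d" for i
    unfolding dual_flag_def using ev(2) that
    by (intro arg_cong[where f = span] SUP_cong) (auto simp: eigenvalue_for_def)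
  have flag_eq: "span (\<Union>j\<in>{i..l}. range (E j)) = span (\<Union>j\<in>{i..l}. eigenspace scale A (\<theta> j))"
    if "l \<le> d" for i l
    using ev(1) that by (intro arg_cong[where f = span] SUP_cong) (auto simp: eigenvalue_for_def)

  have \<kappa>_nz: "\<kappa> i \<noteq> 0" for i using q by (simp add: \<kappa>_def)
  have \<theta>_\<kappa>: "\<theta> i = a * \<kappa> i + inverse a * inverse (\<kappa> i)" for i
    unfolding \<theta>_def \<kappa>_def by (simp flip: power_int_minus)
  \<comment> \<open>\<open>\<theta> i\<close> is a function of \<open>\<kappa> i\<close>, so distinct \<open>\<theta> i\<close> force distinct \<open>\<kappa> i\<close>.\<close>
  have inj_\<kappa>: "inj_on \<kappa> {..d}"
    using inj_\<theta> by (auto simp: inj_on_def \<theta>_\<kappa>)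
  have q_order: "q ^ (2 * m) \<noteq> 1" if "1 \<le> m" "m \<le> d" for m
  proof
    assume "q ^ (2 * m) = 1"
    then have "\<kappa> m = \<kappa> 0"
      unfolding \<kappa>_def using power_int_diff[OF disjI1[OF q(1)], of "int d" "int (2 * m)"]
      by (simp only: power_int_of_nat) simp
    then show False using inj_\<kappa> that by (auto simp: inj_on_def)
  qed

  have endo_K: "endo K" and K_split: "\<And>i v. i \<le> d \<Longrightarrow> v \<in> split_space i \<Longrightarrow> K v = scale (\<kappa> i) v"
    using assms(6)
    by (auto simp: is_K_map_def split_U_def split_space_def flag_def dual_flag_eq flag_eq \<kappa>_def)
  have "(\<Union>i\<le>d. split_space i) \<subseteq> (\<Union>i\<le>d. eigenspace scale K (\<kappa> i))"
    using K_split by (auto simp: eigenspace_iff)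
  then have K_span: "span (\<Union>i\<le>d. eigenspace scale K (\<kappa> i)) = UNIV"
    using split_span span_mono by blast
  \<comment> \<open>Since the \<open>\<kappa> i\<close> are distinct and the split spaces span, they are the full eigenspaces of \<open>K\<close>.\<close>
  have split_K: "v \<in> split_space i" if "i \<le> d" "K v = scale (\<kappa> i) v" for i v
  proof -
    obtain P where lin: "\<And>j. j \<le> d \<Longrightarrow> endo (P j)"
      and delta: "\<And>j l v. j \<le> d \<Longrightarrow> l \<le> d \<Longrightarrow> v \<in> eigenspace scale K (\<kappa> l) \<Longrightarrow>
        P j v = (if j = l then v else 0)"
      by (rule eigenprojections_exist[OF endo_K inj_\<kappa> K_span]) (rule that)
    note P = lin[OF that(1)] delta[OF that(1)]
    have "P i v \<in> split_space i"
    proof (rule endo_span_into[OF P(1)])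
      show "v \<in> span (\<Union>i\<le>d. split_space i)" by (simp add: split_span)
      show "P i s \<in> split_space i" if "s \<in> (\<Union>i\<le>d. split_space i)" for s
        using that P(2) K_split subspace_0[OF subspace_flags(3)] by (auto simp: eigenspace_iff)
    qed (rule subspace_flags)
    then show ?thesis using P(2)[OF that(1)] that(2) by (simp add: eigenspace_iff)
  qed
  have bij_K: "bij K" and endo_Ki: "endo Ki"
    unfolding Ki_def using invertible_if_nonzero_eigenvalues[OF endo_K inj_\<kappa> K_span \<kappa>_nz] by auto
  have Ki_K: "Ki (K v) = v" and K_Ki: "K (Ki v) = v" for v
    using bij_K by (simp_all add: Ki_def bij_is_inj bij_is_surj surj_f_inv_f)

  have R_def: "R v = A v - scale a (K v) - scale (inverse a) (Ki v)" for v
    by (simp add: assms(7) R_map_def Ki_def)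
  have endo_R: "endo R"
    using endo_A endo_K endo_Ki by (intro endoI) (simp_all add: R_def endo_simps algebra_simps)
  \<comment> \<open>$R$ is \<open>A - \<theta> i\<close> on the \<open>i\<close>th weight space, so it raises the split decomposition by one.\<close>
  have R_split: "R v = A v - scale (\<theta> i) v" if "K v = scale (\<kappa> i) v" for i v
  proof -
    have "Ki v = scale (inverse (\<kappa> i)) v"
      using Ki_K[of "scale (inverse (\<kappa> i)) v"] that \<kappa>_nz[of i] endo_K by (simp add: endo_simps)
    then show ?thesis by (simp add: R_def that \<theta>_\<kappa> scale_left_distrib)
  qed
  interpret Q: q_weight_spaces scale K Ki R d q
  proof (intro q_weight_spaces.intro q_weight_spaces_axioms.intro linear_endos_axioms)
    show "span (\<Union>i\<le>d. eigenspace scale K (q powi (int d - 2 * int i))) = UNIV"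
      using K_span by (simp add: \<kappa>_def)
    show "K (R v) = scale (q powi (int d - 2 * int (Suc i))) (R v)"
      if "i < d" "K v = scale (q powi (int d - 2 * int i)) v" for i v
      using that A_split[of i v] split_K[of i v] R_split[of v i] K_split[of "Suc i" "R v"]
      by (simp add: \<kappa>_def)
    show "R v = 0" if "K v = scale (q powi (int d - 2 * int d)) v" for v
      using that A_split_last[of v] split_K[of d v] R_split[of v d] by (simp add: \<kappa>_def)
  qed (use endo_K endo_Ki endo_R q q_order Ki_K in auto)
  have Q_U: "v \<in> Q.U i \<longleftrightarrow> K v = scale (\<kappa> i) v" for v i
    by (simp add: Q.U_iff Q.wt_def \<kappa>_def)

  have endo_\<psi>: "endo \<psi>"
    and \<psi>_R: "\<And>v. \<psi> (R v) - R (\<psi> v) = scale (q - inverse q) (K v - Ki v)"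
    and \<psi>_kills: "\<And>i u. 2 * i \<le> d \<Longrightarrow> u \<in> split_K_space scale d E Es i \<Longrightarrow> \<psi> u = 0"
    using assms(8) by (simp_all add: is_psi_map_def Ki_def)
  have K_\<psi>: "K (\<psi> v) = scale (q ^ 2) (\<psi> (K v))" for v
  proof (rule Q.K_q_commutator)
    show "Q.q_commutator \<psi>" by (simp add: Q.q_commutator_def endo_\<psi> \<psi>_R)
    fix i h assume i: "2 * i \<le> d" and h: "h \<in> Q.U i" "(R ^^ (d - 2 * i + 1)) h = 0"
    have hs: "h \<in> split_space i" using h(1) i split_K by (simp add: Q_U)
    \<comment> \<open>The powers of \<open>R\<close> on \<open>h\<close> are products of the factors \<open>A - \<theta> j\<close> for \<open>i \<le> j \<le> d - i\<close>.\<close>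
    have "h \<in> span (\<Union>j\<in>{i..<i + (d - 2 * i + 1)}. eigenspace scale A (\<theta> j))"
    proof (rule killed_by_factors[where w = "\<lambda>m. (R ^^ m) h"])
      show "(R ^^ Suc m) h = A ((R ^^ m) h) - scale (\<theta> (i + m)) ((R ^^ m) h)"
        if "m < d - 2 * i + 1" for m
        using R_split[of "(R ^^ m) h" "i + m"] Q.R_power_U[of i m h] that i h(1) by (simp add: Q_U)
    qed (use hs h i in \<open>auto simp: split_space_def\<close>)
    moreover have "{i..<i + (d - 2 * i + 1)} = {i..d - i}" using i by auto
    ultimately have "h \<in> split_K_space scale d E Es i"
      using hs i by (simp add: split_K_space_def dual_flag_eq flag_eq split_space_def)
    then show "\<psi> h = 0" using \<psi>_kills i by blast
  qed

  define c where "c = inverse (q - inverse q)"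
  have "q - inverse q \<noteq> 0"
  proof
    assume "q - inverse q = 0"
    then have "q * q = 1" using q(1) by (metis eq_iff_diff_eq_0 right_inverse)
    then have "(q * q) * (q * q) = 1" by simp
    then show False using q(2) by (simp add: power4_eq_xxxx mult.assoc)
  qed
  then have c: "c * (q - inverse q) = 1" by (simp add: c_def)
  interpret M: Uq_operators scale "\<lambda>v. scale c (\<psi> v)" "\<lambda>v. scale c (R v)" K Ki q
  proof (intro Uq_operators.intro Uq_operators_axioms.intro linear_endos_axioms)
    show "endo (\<lambda>v. scale c (\<psi> v))" "endo (\<lambda>v. scale c (R v))"
      using endo_\<psi> endo_R by (auto intro!: endoI simp: endo_simps algebra_simps)
    show "K (scale c (\<psi> (Ki v))) = scale (q ^ 2) (scale c (\<psi> v))"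
      "K (scale c (R (Ki v))) = scale (inverse q ^ 2) (scale c (R v))" for v
      using K_\<psi>[of "Ki v"] Q.K_R[of "Ki v"] endo_K by (simp_all add: endo_simps K_Ki mult.commute)
    have "scale c (\<psi> (scale c (R v))) - scale c (R (scale c (\<psi> v)))
        = scale (c * c) (\<psi> (R v) - R (\<psi> v))" for v
      using endo_\<psi> endo_R by (simp add: endo_simps scale_right_diff_distrib)
    also have "scale (c * c) (\<psi> (R v) - R (\<psi> v)) = scale c (K v - Ki v)" for v
      unfolding \<psi>_R using c by (simp add: mult.assoc)
    finally show "scale c (\<psi> (scale c (R v))) - scale c (R (scale c (\<psi> v)))
        = scale (inverse (q - inverse q)) (K v - Ki v)" for v
      unfolding c_def .
  qed (fact endo_K endo_Ki K_Ki Ki_K)+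
  have "M.act (Uq_gen q Gen_e) v = scale (inverse (q - inverse q)) (\<psi> v)"
    "M.act (Uq_gen q Gen_f) v = scale (inverse (q - inverse q)) (R v)"
    "M.act (Uq_gen q Gen_k) v = K v" "M.act (Uq_gen q Gen_ki) v = inv_into UNIV K v" for v
    by (simp_all only: M.act_gen M.gen_op_def chev.case c_def[symmetric] Ki_def[symmetric])
  then show ?thesis
    using M.Uq_module_act by blast
qed

end
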